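(* Let $k$ be an algebraically closed field and let $G_{1},\ldots ,G_{n}$ be finitely presented groups. Then there exist a finite, connected quiver $\hat{Q}$ without oriented cycles and admissible ideals $I_{1},\ldots ,I_{n}$ of the path algebra $k\hat{Q}$ such that $k\hat{Q}/I_{1}\cong k\hat{Q}/I_{2}\cong \cdots \cong k\hat{Q}/I_{n}$ (i.e. the $(\hat{Q},I_{i})$ are presentations of one and the same triangular algebra $A$) and $\pi _{1}(\hat{Q},I_{i})\cong G_{i}$ for every $i=1,\ldots ,n$.
   Context: A quiver $Q$ consists of finite sets of vertices $Q_0$ and arrows $Q_1$ with source and target maps; $kQ$ is its path algebra (basis: all paths, including a stationary path $e_x$ for each vertex $x$). Let $F$ be the two-sided ideal of $kQ$ generated by the arrows. A two-sided ideal $I$ of $kQ$ is admissible if $F^{m}\subseteq I\subseteq F^{2}$ for some $m\geq 2$. A presentation of a basic connected finite-dimensional $k$-algebra $A$ is a pair $(Q,I)$ with $I$ admissible and $kQ/I\cong A$. $A$ (or $Q$) is triangular if $Q$ has no oriented cycles. Fundamental group: for vertices $x,y$ let $I(x,y)=e_x(kQ)e_y\cap I$. A relation $\rho=\sum_{i=1}^{m}\lambda_i w_i\in I(x,y)$ (with $\lambda_i\in k^{*}$ and $w_i$ distinct paths from $x$ to $y$) is minimal if $m\geq 2$ and for every proper nonempty subset $J\subset\{1,\ldots,m\}$, $\sum_{i\in J}\lambda_i w_i\notin I(x,y)$. For each arrow $\alpha:x\to y$ let $\alpha^{-1}$ be a formal inverse from $y$ to $x$; a walk is a composable sequence of arrows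 and formal inverses. Homotopy $\sim$ is the smallest equivalence relation on walks such that $\alpha\alpha^{-1}\sim e_x$, $\alpha^{-1}\alpha\sim e_y$ for every arrow $\alpha:x\to y$; $w_i\sim w_j$ for all paths $w_i,w_j$ occurring in a common minimal relation $\sum\lambda_i w_i$ of $I$; and $u\sim v$ implies $wuw'\sim wvw'$ whenever defined. For a vertex $v_0$, $\pi_1(Q,I,v_0)$ is the group of homotopy classes of closed walks at $v_0$ under concatenation; for connected $Q$ it is independent of $v_0$ and denoted $\pi_1(Q,I)$. *)

theory Defs
  imports "HOL-Algebra.Group" "HOL-Computational_Algebra.Polynomial"
begin

definition alg_closed_field :: "'k::field itself \<Rightarrow> bool" where
  "alg_closed_field _ \<longleftrightarrow> (\<forall>p::'k poly. degree p > 0 \<longrightarrow> (\<exists>x. poly p x = 0))"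

record quiver =
  verts :: "nat set"
  arrs  :: "nat set"
  src   :: "nat \<Rightarrow> nat"
  tgt   :: "nat \<Rightarrow> nat"

definition finite_quiver :: "quiver \<Rightarrow> bool" where
  "finite_quiver Q \<longleftrightarrow> finite (verts Q) \<and> finite (arrs Q) \<and>
     (\<forall>a\<in>arrs Q. src Q a \<in> verts Q \<and> tgt Q a \<in> verts Q)"

text \<open>A walk is a start vertex together with a list of steps (a, True) = arrow a,
  (a, False) = formal inverse of a. walk_end returns the end vertex, or None
  if the walk is not composable.\<close>

fun walk_end :: "quiver \<Rightarrow> nat \<Rightarrow> (nat \<times> bool) list \<Rightarrow> nat option" where
  "walk_end Q x [] = (if x \<in> verts Q then Some x else None)"
| "walk_end Q x ((a, d) # s) =
     (if x \<in> verts Q \<and> a \<in> arrs Q \<and> (if d then src Q a else tgt Q a) = x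
      then walk_end Q (if d then tgt Q a else src Q a) s else None)"

type_synonym walk = "nat \<times> (nat \<times> bool) list"
type_synonym path = "nat \<times> nat list"   \<comment> \<open>start vertex, arrows composed left to right\<close>

definition fwd :: "nat list \<Rightarrow> (nat \<times> bool) list" where
  "fwd as = map (\<lambda>a. (a, True)) as"

definition is_path :: "quiver \<Rightarrow> path \<Rightarrow> bool" where
  "is_path Q p \<longleftrightarrow> walk_end Q (fst p) (fwd (snd p)) \<noteq> None"

definition path_end :: "quiver \<Rightarrow> path \<Rightarrow> nat" where
  "path_end Q p = the (walk_end Q (fst p) (fwd (snd p)))"

definition connected_quiver :: "quiver \<Rightarrow> bool" where
  "connected_quiver Q \<longleftrightarrow> verts Q \<noteq> {} \<and>
     (\<forall>x\<in>verts Q. \<forall>y\<in>verts Q. \<exists>s. walk_end Q x s = Some y)"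

definition no_oriented_cycles :: "quiver \<Rightarrow> bool" where
  "no_oriented_cycles Q \<longleftrightarrow>
     \<not> (\<exists>x as. as \<noteq> [] \<and> is_path Q (x, as) \<and> path_end Q (x, as) = x)"

definition path_alg :: "quiver \<Rightarrow> (path \<Rightarrow> 'k::field) set" where
  "path_alg Q = {f. finite {p. f p \<noteq> 0} \<and> (\<forall>p. f p \<noteq> 0 \<longrightarrow> is_path Q p)}"

definition pa_add :: "(path \<Rightarrow> 'k::field) \<Rightarrow> (path \<Rightarrow> 'k) \<Rightarrow> path \<Rightarrow> 'k" where
  "pa_add f g = (\<lambda>p. f p + g p)"

definition pa_diff :: "(path \<Rightarrow> 'k::field) \<Rightarrow> (path \<Rightarrow> 'k) \<Rightarrow> path \<Rightarrow> 'k" where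
  "pa_diff f g = (\<lambda>p. f p - g p)"

definition pa_smult :: "'k::field \<Rightarrow> (path \<Rightarrow> 'k) \<Rightarrow> path \<Rightarrow> 'k" where
  "pa_smult c f = (\<lambda>p. c * f p)"

text \<open>Multiplication: bilinear extension of concatenation of paths (the product
  of two non-composable paths is zero).\<close>

definition pa_mult :: "quiver \<Rightarrow> (path \<Rightarrow> 'k::field) \<Rightarrow> (path \<Rightarrow> 'k) \<Rightarrow> path \<Rightarrow> 'k" where
  "pa_mult Q f g = (\<lambda>(x, as). if is_path Q (x, as) then
      (\<Sum>i\<in>{0..length as}. f (x, take i as) * g (path_end Q (x, take i as), drop i as))
    else 0)"

definition pa_one :: "quiver \<Rightarrow> path \<Rightarrow> 'k::field" where
  "pa_one Q = (\<lambda>p. if snd p = [] \<and> fst p \<in> verts Q then 1 else 0)"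

definition arrow_elt :: "quiver \<Rightarrow> nat \<Rightarrow> path \<Rightarrow> 'k::field" where
  "arrow_elt Q a = (\<lambda>p. if p = (src Q a, [a]) then 1 else 0)"

definition pa_ideal :: "quiver \<Rightarrow> (path \<Rightarrow> 'k::field) set \<Rightarrow> bool" where
  "pa_ideal Q I \<longleftrightarrow> I \<subseteq> path_alg Q \<and> (\<lambda>_. 0) \<in> I \<and>
     (\<forall>a\<in>I. \<forall>b\<in>I. pa_add a b \<in> I) \<and> (\<forall>a\<in>I. \<forall>c. pa_smult c a \<in> I) \<and>
     (\<forall>a\<in>I. \<forall>f\<in>path_alg Q. pa_mult Q f a \<in> I \<and> pa_mult Q a f \<in> I)"

definition gen_ideal :: "quiver \<Rightarrow> (path \<Rightarrow> 'k::field) set \<Rightarrow> (path \<Rightarrow> 'k) set" where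
  "gen_ideal Q S = \<Inter>{I. pa_ideal Q I \<and> S \<subseteq> I}"

definition arrow_ideal :: "quiver \<Rightarrow> (path \<Rightarrow> 'k::field) set" where
  "arrow_ideal Q = gen_ideal Q (arrow_elt Q ` arrs Q)"

fun ideal_power :: "quiver \<Rightarrow> (path \<Rightarrow> 'k::field) set \<Rightarrow> nat \<Rightarrow> (path \<Rightarrow> 'k) set" where
  "ideal_power Q J 0 = path_alg Q"
| "ideal_power Q J (Suc m) =
     gen_ideal Q {pa_mult Q a b | a b. a \<in> ideal_power Q J m \<and> b \<in> J}"

definition admissible :: "quiver \<Rightarrow> (path \<Rightarrow> 'k::field) set \<Rightarrow> bool" where
  "admissible Q I \<longleftrightarrow> pa_ideal Q I \<and>
     (\<exists>m\<ge>2. ideal_power Q (arrow_ideal Q) m \<subseteq> I) \<and> I \<subseteq> ideal_power Q (arrow_ideal Q) 2"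

text \<open>kQ/I \<cong> kQ/J as k-algebras, expressed through a lift phi : kQ \<rightarrow> kQ of the
  isomorphism (every isomorphism of the quotients admits such a lift).\<close>

definition quotients_iso :: "quiver \<Rightarrow> (path \<Rightarrow> 'k::field) set \<Rightarrow> (path \<Rightarrow> 'k) set \<Rightarrow> bool" where
  "quotients_iso Q I J \<longleftrightarrow> (\<exists>\<phi>.
     (\<forall>a\<in>path_alg Q. \<phi> a \<in> path_alg Q) \<and>
     (\<forall>a\<in>path_alg Q. \<forall>b\<in>path_alg Q. pa_diff a b \<in> I \<longleftrightarrow> pa_diff (\<phi> a) (\<phi> b) \<in> J) \<and>
     (\<forall>c\<in>path_alg Q. \<exists>a\<in>path_alg Q. pa_diff (\<phi> a) c \<in> J) \<and>
     (\<forall>a\<in>path_alg Q. \<forall>b\<in>path_alg Q. pa_diff (\<phi> (pa_add a b)) (pa_add (\<phi> a) (\<phi> b)) \<in> J) \<and>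
     (\<forall>a\<in>path_alg Q. \<forall>c. pa_diff (\<phi> (pa_smult c a)) (pa_smult c (\<phi> a)) \<in> J) \<and>
     (\<forall>a\<in>path_alg Q. \<forall>b\<in>path_alg Q. pa_diff (\<phi> (pa_mult Q a b)) (pa_mult Q (\<phi> a) (\<phi> b)) \<in> J) \<and>
     pa_diff (\<phi> (pa_one Q)) (pa_one Q) \<in> J)"

definition supp :: "(path \<Rightarrow> 'k::field) \<Rightarrow> path set" where
  "supp \<rho> = {p. \<rho> p \<noteq> 0}"

definition minimal_relation :: "quiver \<Rightarrow> (path \<Rightarrow> 'k::field) set \<Rightarrow> (path \<Rightarrow> 'k) \<Rightarrow> bool" where
  "minimal_relation Q I \<rho> \<longleftrightarrow> \<rho> \<in> I \<and>
     (\<exists>x y. \<forall>p\<in>supp \<rho>. fst p = x \<and> path_end Q p = y) \<and>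
     card (supp \<rho>) \<ge> 2 \<and>
     (\<forall>K. K \<subset> supp \<rho> \<and> K \<noteq> {} \<longrightarrow> (\<lambda>p. if p \<in> K then \<rho> p else 0) \<notin> I)"

inductive htpy :: "quiver \<Rightarrow> (path \<Rightarrow> 'k::field) set \<Rightarrow> walk \<Rightarrow> walk \<Rightarrow> bool"
  for Q :: quiver and I :: "(path \<Rightarrow> 'k::field) set" where
  h_refl: "walk_end Q x s \<noteq> None \<Longrightarrow> htpy Q I (x, s) (x, s)"
| h_sym: "htpy Q I u v \<Longrightarrow> htpy Q I v u"
| h_trans: "htpy Q I u v \<Longrightarrow> htpy Q I v w \<Longrightarrow> htpy Q I u w"
| h_cancel1: "a \<in> arrs Q \<Longrightarrow> htpy Q I (src Q a, [(a, True), (a, False)]) (src Q a, [])"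
| h_cancel2: "a \<in> arrs Q \<Longrightarrow> htpy Q I (tgt Q a, [(a, False), (a, True)]) (tgt Q a, [])"
| h_rel: "minimal_relation Q I \<rho> \<Longrightarrow> p \<in> supp \<rho> \<Longrightarrow> q \<in> supp \<rho> \<Longrightarrow>
          htpy Q I (fst p, fwd (snd p)) (fst q, fwd (snd q))"
| h_ctx: "htpy Q I (x, u) (x, v) \<Longrightarrow> walk_end Q z w = Some x \<Longrightarrow>
          walk_end Q z (w @ u @ w') \<noteq> None \<Longrightarrow> walk_end Q z (w @ v @ w') \<noteq> None \<Longrightarrow>
          htpy Q I (z, w @ u @ w') (z, w @ v @ w')"

definition quot_monoid :: "('w \<Rightarrow> 'w \<Rightarrow> bool) \<Rightarrow> 'w set \<Rightarrow> ('w \<Rightarrow> 'w \<Rightarrow> 'w) \<Rightarrow> 'w \<Rightarrow> 'w set monoid" where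
  "quot_monoid R D app e =
     \<lparr>carrier = (\<lambda>w. {v. R w v}) ` D,
      monoid.mult = (\<lambda>A B. {v. R (app (SOME a. a \<in> A \<inter> D) (SOME b. b \<in> B \<inter> D)) v}),
      monoid.one = {v. R e v}\<rparr>"

definition pi1 :: "quiver \<Rightarrow> (path \<Rightarrow> 'k::field) set \<Rightarrow> nat \<Rightarrow> walk set monoid" where
  "pi1 Q I v0 = quot_monoid (htpy Q I) {(v0, s) | s. walk_end Q v0 s = Some v0}
     (\<lambda>(x, s) (y, t). (x, s @ t)) (v0, [])"

text \<open>Words over generators: (x, True) = x, (x, False) = x^-1.  The group
  presented by generators X and relators R is the set of words over X modulo
  free cancellation and insertion/deletion of relators.\<close>

inductive pres_eq :: "(nat \<times> bool) list set \<Rightarrow> (nat \<times> bool) list \<Rightarrow> (nat \<times> bool) list \<Rightarrow> bool"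
  for R where
  pe_refl: "pres_eq R u u"
| pe_sym: "pres_eq R u v \<Longrightarrow> pres_eq R v u"
| pe_trans: "pres_eq R u v \<Longrightarrow> pres_eq R v w \<Longrightarrow> pres_eq R u w"
| pe_cancel: "pres_eq R (u @ [(x, b), (x, \<not> b)] @ v) (u @ v)"
| pe_rel: "r \<in> R \<Longrightarrow> pres_eq R (u @ r @ v) (u @ v)"

definition presented_group :: "nat set \<Rightarrow> (nat \<times> bool) list set \<Rightarrow> (nat \<times> bool) list set monoid" where
  "presented_group X R = quot_monoid (pres_eq R) (lists (X \<times> UNIV)) (@) []"

definition finitely_presented :: "('g, 'm) monoid_scheme \<Rightarrow> bool" where
  "finitely_presented G \<longleftrightarrow> group G \<and>
     (\<exists>X R. finite X \<and> finite R \<and> R \<subseteq> lists (X \<times> UNIV) \<and> G \<cong> presented_group X R)"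

end

theory Submission
  imports Defs "HOL-Library.Countable"
begin

text \<open>
  All groups are realised at once on a quiver whose paths have length at most 2. Arrows
  \<open>a_g: 0 \<rightarrow> 1\<close> and \<open>b_g: 1 \<rightarrow> 2\<close> are labelled by a common unit and by the nonempty words
  of bounded length over the generators of each group; there are two further arrows
  \<open>c: 1 \<rightarrow> 3\<close> and \<open>d: 4 \<rightarrow> 1\<close>. Let \<open>I0\<close> be spanned by the binomials
  \<open>a_u b_v - a_u' b_v'\<close>, whenever \<open>u v = u' v'\<close> holds in one of the groups, and by the
  monomials \<open>a_g c\<close> and \<open>d b_g\<close> for \<open>g\<close> not the unit. The binomials force the
  multiplication of the group on the loops \<open>a_g a_1^-1\<close>, whereas monomials have no effect on
  homotopy. The ideal \<open>I_i\<close> is the image of \<open>I0\<close> under the automorphism that replaces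
  \<open>a_g\<close>, \<open>b_g\<close> by \<open>a_g - a_1\<close>, \<open>b_g - b_1\<close> for all labels \<open>g\<close> from groups other than
  the \<open>i\<close>-th. This turns \<open>a_g c\<close> and \<open>d b_g\<close> into the minimal relations
  \<open>(a_g - a_1) c\<close> and \<open>d (b_g - b_1)\<close>, which kill \<open>g\<close> in the fundamental group. No further
  homotopies arise, because \<open>I_i\<close> is homogeneous for the grading of the paths by the
  \<open>i\<close>-th group, so that its minimal relations are homogeneous.
\<close>

section \<open>Linear substitutions of arrows\<close>

lemma walk_end_Some_start: "walk_end Q x s = Some y \<Longrightarrow> x \<in> verts Q"
  by (cases s) (auto split: if_splits)

lemma walk_end_append:
  "walk_end Q x (s @ t) = (case walk_end Q x s of None \<Rightarrow> None | Some y \<Rightarrow> walk_end Q y t)"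
proof (induction s arbitrary: x)
  case Nil
  show ?case by (cases t) auto
next
  case (Cons e s)
  then show ?case by (cases e) auto
qed

lemma walk_end_fwd_parallel:
  assumes "list_all2 (\<lambda>a b. a \<in> arrs Q \<and> b \<in> arrs Q \<and> src Q b = src Q a \<and> tgt Q b = tgt Q a) as bs"
  shows "walk_end Q x (fwd as) = walk_end Q x (fwd bs)"
  using assms by (induction as bs arbitrary: x rule: list_all2_induct) (auto simp: fwd_def)

section \<open>Basis elements and linear operations\<close>

definition basis_elt :: "path \<Rightarrow> path \<Rightarrow> 'k::field" where
  "basis_elt p = (\<lambda>q. if q = p then 1 else 0)"

lemma basis_elt_in_path_alg: "is_path Q p \<Longrightarrow> basis_elt p \<in> path_alg Q"
  by (auto simp: path_alg_def basis_elt_def)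

lemma pa_add_in_path_alg:
  assumes "f \<in> path_alg Q" "g \<in> path_alg Q"
  shows "pa_add f g \<in> path_alg Q"
proof -
  have "{p. f p + g p \<noteq> 0} \<subseteq> {p. f p \<noteq> 0} \<union> {p. g p \<noteq> 0}" by auto
  then show ?thesis
    using assms unfolding path_alg_def pa_add_def
    by (auto intro: finite_subset)
qed

lemma pa_smult_in_path_alg: "f \<in> path_alg Q \<Longrightarrow> pa_smult c f \<in> path_alg Q"
  unfolding path_alg_def pa_smult_def by (auto intro: rev_finite_subset)

lemma pa_diff_conv: "pa_diff f g = pa_add f (pa_smult (- 1) g)"
  by (auto simp: pa_diff_def pa_add_def pa_smult_def)

lemma pa_diff_in_path_alg: "f \<in> path_alg Q \<Longrightarrow> g \<in> path_alg Q \<Longrightarrow> pa_diff f g \<in> path_alg Q"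
  unfolding pa_diff_conv by (intro pa_add_in_path_alg pa_smult_in_path_alg)

text \<open>\<open>base\<close> picks a distinguished parallel arrow for every arrow. Being parallel
  keeps endpoints intact when a multiple of \<open>base b\<close> is added to \<open>b\<close>;
  idempotence keeps corrections from spreading further when such substitutions are iterated.\<close>

locale arrow_shift =
  fixes Q :: quiver and base :: "nat \<Rightarrow> nat"
  assumes finite_Q: "finite_quiver Q"
    and base_arrow: "a \<in> arrs Q \<Longrightarrow> base a \<in> arrs Q"
    and src_base: "a \<in> arrs Q \<Longrightarrow> src Q (base a) = src Q a"
    and tgt_base: "a \<in> arrs Q \<Longrightarrow> tgt Q (base a) = tgt Q a"
    and base_base: "a \<in> arrs Q \<Longrightarrow> base (base a) = base a"
begin

lemma finite_arrs [simp]: "finite (arrs Q)"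
  using finite_Q by (simp add: finite_quiver_def)

text \<open>The coefficient of the arrow \<open>a\<close> in the image of the arrow
  \<open>b\<close>. At \<open>a = b = base b\<close> both summands contribute, so a base arrow is
  fixed only if \<open>l\<close> vanishes there.\<close>

definition mat :: "(nat \<Rightarrow> 'k::field) \<Rightarrow> nat \<Rightarrow> nat \<Rightarrow> 'k" where
  "mat l b a = (if a = b then 1 else 0) + (if a = base b then l b else 0)"

text \<open>The image coefficient at \<open>as\<close> is the sum of \<open>F bs\<close> over all
  lists \<open>bs\<close> of arrows of the same length, weighted by the product of the matrix
  entries. Passing \<open>F\<close> as a function lets the recursion run letter by letter.\<close>

primrec shift_list :: "(nat \<Rightarrow> 'k::field) \<Rightarrow> nat list \<Rightarrow> (nat list \<Rightarrow> 'k) \<Rightarrow> 'k" where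
  "shift_list l [] F = F []"
| "shift_list l (a # as) F = (\<Sum>b\<in>arrs Q. mat l b a * shift_list l as (\<lambda>bs. F (b # bs)))"

text \<open>In coordinates, the algebra endomorphism of the path algebra that substitutes
  \<open>b + l b * base b\<close> for every arrow \<open>b\<close>.\<close>

definition shift :: "(nat \<Rightarrow> 'k::field) \<Rightarrow> (path \<Rightarrow> 'k) \<Rightarrow> path \<Rightarrow> 'k" where
  "shift l f = (\<lambda>(x, as). shift_list l as (\<lambda>bs. f (x, bs)))"

definition linked :: "(nat \<Rightarrow> 'k::field) \<Rightarrow> nat list \<Rightarrow> nat list \<Rightarrow> bool" where
  "linked l = list_all2 (\<lambda>a b. b \<in> arrs Q \<and> mat l b a \<noteq> 0)"

lemma mat_nonzero: "mat l b a \<noteq> 0 \<Longrightarrow> a = b \<or> a = base b \<and> l b \<noteq> 0"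
  by (auto simp: mat_def split: if_splits)

lemma linked_parallel:
  assumes "linked l as bs"
  shows "list_all2 (\<lambda>a b. a \<in> arrs Q \<and> b \<in> arrs Q \<and> src Q b = src Q a \<and> tgt Q b = tgt Q a) as bs"
  using assms unfolding linked_def
  by (rule list_all2_mono) (auto dest!: mat_nonzero simp: base_arrow src_base tgt_base)

lemma linked_walk_end: "linked l as bs \<Longrightarrow> walk_end Q x (fwd as) = walk_end Q x (fwd bs)"
  by (rule walk_end_fwd_parallel) (rule linked_parallel)

lemma linked_is_path: "linked l as bs \<Longrightarrow> is_path Q (x, as) = is_path Q (x, bs)"
  by (simp add: is_path_def linked_walk_end)

lemma linked_path_end: "linked l as bs \<Longrightarrow> path_end Q (x, as) = path_end Q (x, bs)"
  by (simp add: path_end_def linked_walk_end)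

lemma linked_length: "linked l as bs \<Longrightarrow> length as = length bs"
  by (auto simp: linked_def list_all2_lengthD)

lemma linked_take: "linked l as bs \<Longrightarrow> linked l (take i as) (take i bs)"
  by (simp add: linked_def list_all2_takeI)

text \<open>Off the linked lists some matrix entry is zero, so \<open>F\<close> matters only on
  linked ones. These agree with \<open>as\<close> in length and are parallel to it arrow by arrow,
  which is how path conditions and end vertices are moved out of the sum.\<close>

lemma shift_list_cong:
  "(\<And>bs. linked l as bs \<Longrightarrow> F bs = G bs) \<Longrightarrow> shift_list l as F = shift_list l as G"
proof (induction as arbitrary: F G)
  case Nil
  then show ?case by (simp add: linked_def)
next
  case (Cons a as)
  have "mat l b a * shift_list l as (\<lambda>bs. F (b # bs)) = mat l b a * shift_list l as (\<lambda>bs. G (b # bs))"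
    if "b \<in> arrs Q" for b
  proof (cases "mat l b a = 0")
    case False
    have "shift_list l as (\<lambda>bs. F (b # bs)) = shift_list l as (\<lambda>bs. G (b # bs))"
      by (rule Cons.IH) (use False that in \<open>auto intro!: Cons.prems simp: linked_def\<close>)
    then show ?thesis by simp
  qed simp
  then show ?case unfolding shift_list.simps by (rule sum.cong[OF refl])
qed

lemma shift_list_add: "shift_list l as (\<lambda>bs. F bs + G bs) = shift_list l as F + shift_list l as G"
  by (induction as arbitrary: F G) (auto simp: distrib_left sum.distrib)

lemma shift_list_mult_left: "shift_list l as (\<lambda>bs. c * F bs) = c * shift_list l as F"
  by (induction as arbitrary: F) (auto simp: sum_distrib_left algebra_simps)

lemma shift_list_mult_right: "shift_list l as (\<lambda>bs. F bs * c) = shift_list l as F * c"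
  using shift_list_mult_left[of l as c F] by (simp add: mult.commute)

lemma shift_list_zero [simp]: "shift_list l as (\<lambda>bs. 0) = 0"
  using shift_list_mult_left[of l as 0] by simp

lemma shift_list_sum:
  "shift_list l as (\<lambda>bs. \<Sum>i\<in>A. F i bs) = (\<Sum>i\<in>A. shift_list l as (F i))"
  by (induction A rule: infinite_finite_induct) (auto simp: shift_list_add)

lemma shift_list_append:
  "shift_list l (as @ as') F = shift_list l as (\<lambda>bs. shift_list l as' (\<lambda>bs'. F (bs @ bs')))"
  by (induction as arbitrary: F) auto

lemma shift_list_zeroI: "(\<And>bs. linked l as bs \<Longrightarrow> F bs = 0) \<Longrightarrow> shift_list l as F = 0"
  using shift_list_cong[of l as F "\<lambda>_. 0"] by simp

lemma shift_nonzeroE: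
  assumes "shift l f (x, as) \<noteq> 0"
  obtains bs where "linked l as bs" "f (x, bs) \<noteq> 0"
  using assms shift_list_zeroI[of l as "\<lambda>bs. f (x, bs)"] unfolding shift_def by auto

section \<open>Substitutions as algebra endomorphisms and their composition\<close>

lemma shift_add: "shift l (pa_add f g) = pa_add (shift l f) (shift l g)"
  by (auto simp: shift_def pa_add_def shift_list_add)

lemma shift_smult: "shift l (pa_smult c f) = pa_smult c (shift l f)"
  by (auto simp: shift_def pa_smult_def shift_list_mult_left)

lemma shift_diff: "shift l (pa_diff f g) = pa_diff (shift l f) (shift l g)"
  by (simp add: pa_diff_conv shift_add shift_smult)

lemma shift_zero: "shift l (\<lambda>_. 0) = (\<lambda>_. 0)"
  by (auto simp: shift_def)

lemma shift_in_path_alg: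
  assumes "f \<in> path_alg Q"
  shows "shift l f \<in> path_alg Q"
proof -
  have path: "is_path Q p" if "shift l f p \<noteq> 0" for p
  proof -
    obtain x as where p: "p = (x, as)" by (cases p)
    then obtain bs where "linked l as bs" "f (x, bs) \<noteq> 0" using \<open>shift l f p \<noteq> 0\<close> by (auto elim: shift_nonzeroE)
    then show ?thesis using assms p linked_is_path[of l as bs x] by (simp add: path_alg_def)
  qed
  \<comment> \<open>Each path in the support of \<open>f\<close> spreads only to lists of arrows
    with the same start and length, of which there are finitely many.\<close>
  have "{p. shift l f p \<noteq> 0} \<subseteq>
      (\<Union>q\<in>{q. f q \<noteq> 0}. {fst q} \<times> {as. set as \<subseteq> arrs Q \<and> length as = length (snd q)})"
  proof
    fix p assume "p \<in> {p. shift l f p \<noteq> 0}"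
    moreover obtain x as where p: "p = (x, as)" by (cases p)
    ultimately obtain bs where bs: "linked l as bs" "f (x, bs) \<noteq> 0" by (auto elim: shift_nonzeroE)
    from linked_parallel[OF bs(1)] have "set as \<subseteq> arrs Q"
      by (auto simp: list_all2_conv_all_nth in_set_conv_nth)
    then show "p \<in> (\<Union>q\<in>{q. f q \<noteq> 0}. {fst q} \<times> {as. set as \<subseteq> arrs Q \<and> length as = length (snd q)})"
      using bs p linked_length[OF bs(1)] by force
  qed
  moreover have "finite \<dots>"
    using assms by (auto simp: path_alg_def finite_lists_length_eq)
  ultimately have "finite {p. shift l f p \<noteq> 0}" by (rule finite_subset)
  with path show ?thesis by (auto simp: path_alg_def)
qed

text \<open>The weights are products over single arrows, so for each cut position the weighted sum
  factors into one sum per piece. Linked lists have the same vertex at the cut, so the composition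
  point is not affected.\<close>

lemma shift_mult: "shift l (pa_mult Q f g) = pa_mult Q (shift l f) (shift l g)"
proof
  fix p :: path
  obtain x as where p: "p = (x, as)" by (cases p)
  show "shift l (pa_mult Q f g) p = pa_mult Q (shift l f) (shift l g) p"
  proof (cases "is_path Q (x, as)")
    case False
    have "shift_list l as (\<lambda>bs. pa_mult Q f g (x, bs)) = 0"
      by (rule shift_list_zeroI) (use False linked_is_path in \<open>auto simp: pa_mult_def\<close>)
    then show ?thesis using False p by (simp add: shift_def pa_mult_def)
  next
    case True
    let ?e = "\<lambda>i. path_end Q (x, take i as)"
    have split: "shift_list l as (\<lambda>bs. f (x, take i bs) * g (?e i, drop i bs)) =
        shift l f (x, take i as) * shift l g (?e i, drop i as)" if "i \<le> length as" for i
    proof -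
      have "shift_list l as (\<lambda>bs. f (x, take i bs) * g (?e i, drop i bs)) =
          shift_list l (take i as @ drop i as) (\<lambda>bs. f (x, take i bs) * g (?e i, drop i bs))"
        by simp
      also have "\<dots> = shift_list l (take i as) (\<lambda>bs. shift_list l (drop i as)
          (\<lambda>bs'. f (x, take i (bs @ bs')) * g (?e i, drop i (bs @ bs'))))"
        by (rule shift_list_append)
      also have "\<dots> = shift_list l (take i as) (\<lambda>bs. shift_list l (drop i as)
          (\<lambda>bs'. f (x, bs) * g (?e i, bs')))"
        by (intro shift_list_cong) (use that in \<open>auto dest!: linked_length\<close>)
      finally show ?thesis
        by (simp add: shift_def shift_list_mult_left shift_list_mult_right)
    qed
    have "shift_list l as (\<lambda>bs. pa_mult Q f g (x, bs)) =
        shift_list l as (\<lambda>bs. \<Sum>i=0..length as. f (x, take i bs) * g (?e i, drop i bs))"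
    proof (rule shift_list_cong)
      fix bs assume bs: "linked l as bs"
      have "path_end Q (x, take i bs) = ?e i" for i
        using linked_path_end[OF linked_take[OF bs]] by simp
      then show "pa_mult Q f g (x, bs) = (\<Sum>i=0..length as. f (x, take i bs) * g (?e i, drop i bs))"
        using True linked_is_path[OF bs] linked_length[OF bs] by (simp add: pa_mult_def)
    qed
    also have "\<dots> = (\<Sum>i=0..length as. shift l f (x, take i as) * shift l g (?e i, drop i as))"
      by (simp add: shift_list_sum split)
    finally show ?thesis using True p by (simp add: shift_def pa_mult_def)
  qed
qed

lemma shift_one: "shift l (pa_one Q) = pa_one Q"
proof
  fix p :: path
  obtain x as where p: "p = (x, as)" by (cases p)
  show "shift l (pa_one Q) p = pa_one Q p"
  proof (cases as)
    case (Cons a as')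
    have "shift_list l as (\<lambda>bs. pa_one Q (x, bs)) = 0"
      by (rule shift_list_zeroI) (use Cons in \<open>auto simp: pa_one_def dest: linked_length\<close>)
    then show ?thesis using p Cons by (simp add: shift_def pa_one_def)
  qed (simp add: p shift_def)
qed

text \<open>The substitution for \<open>m\<close> acts first and produces the correction
  \<open>base c\<close>; since \<open>l\<close> vanishes on base arrows, the second substitution
  fixes it. No product of \<open>l\<close> and \<open>m\<close> arises, so the parameters simply
  add.\<close>

lemma sum_mat_mat:
  assumes "c \<in> arrs Q" and l: "\<And>a. a \<in> arrs Q \<Longrightarrow> l (base a) = 0"
  shows "(\<Sum>b\<in>arrs Q. mat l b a * mat m c b) = mat (\<lambda>e. l e + m e) c a"
proof -
  have "(\<Sum>b\<in>arrs Q. mat l b a * mat m c b) =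
      (\<Sum>b\<in>arrs Q. if c = b then mat l b a else 0) + (\<Sum>b\<in>arrs Q. if base c = b then mat l b a * m c else 0)"
    unfolding sum.distrib[symmetric] by (rule sum.cong) (auto simp: mat_def[of m] algebra_simps)
  also have "\<dots> = mat l c a + mat l (base c) a * m c"
    using assms base_arrow by (simp add: sum.delta')
  finally show ?thesis
    using assms by (auto simp: mat_def base_base)
qed

lemma shift_list_shift_list:
  assumes l: "\<And>a. a \<in> arrs Q \<Longrightarrow> l (base a) = 0"
  shows "shift_list l as (\<lambda>bs. shift_list m bs F) = shift_list (\<lambda>e. l e + m e) as F"
proof (induction as arbitrary: F)
  case (Cons a as)
  have "shift_list l (a # as) (\<lambda>bs. shift_list m bs F) =
      (\<Sum>b\<in>arrs Q. \<Sum>c\<in>arrs Q. mat l b a * mat m c b * shift_list (\<lambda>e. l e + m e) as (\<lambda>cs. F (c # cs)))"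
    by (simp add: shift_list_sum shift_list_mult_left Cons.IH sum_distrib_left mult.assoc)
  also have "\<dots> = (\<Sum>c\<in>arrs Q. (\<Sum>b\<in>arrs Q. mat l b a * mat m c b) * shift_list (\<lambda>e. l e + m e) as (\<lambda>cs. F (c # cs)))"
    by (subst sum.swap) (simp add: sum_distrib_right)
  finally show ?case by (simp add: sum_mat_mat l)
qed simp

lemma shift_shift:
  assumes "\<And>a. a \<in> arrs Q \<Longrightarrow> l (base a) = 0"
  shows "shift l (shift m f) = shift (\<lambda>e. l e + m e) f"
  by (auto simp: shift_def shift_list_shift_list assms)

lemma shift_list_null:
  "set as \<subseteq> arrs Q \<Longrightarrow> shift_list (\<lambda>_. 0) as F = F as"
proof (induction as arbitrary: F)
  case (Cons a as)
  have "shift_list (\<lambda>_. 0) (a # as) F = (\<Sum>b\<in>arrs Q. if a = b then F (b # as) else 0)"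
    unfolding shift_list.simps by (rule sum.cong) (use Cons in \<open>auto simp: mat_def\<close>)
  then show ?case using Cons.prems by (simp add: sum.delta')
qed simp

lemma is_path_arrs: "is_path Q (x, as) \<Longrightarrow> set as \<subseteq> arrs Q"
proof (induction as arbitrary: x)
  case (Cons a as)
  then have "a \<in> arrs Q" "is_path Q (tgt Q a, as)"
    by (auto simp: is_path_def fwd_def split: if_splits)
  then show ?case using Cons.IH by simp
qed simp

lemma shift_null:
  assumes "f \<in> path_alg Q"
  shows "shift (\<lambda>_. 0) f = f"
proof
  fix p :: path
  obtain x as where p: "p = (x, as)" by (cases p)
  show "shift (\<lambda>_. 0) f p = f p"
  proof (cases "f p = 0")
    case False
    then have "set as \<subseteq> arrs Q" using assms p is_path_arrs by (auto simp: path_alg_def)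
    then show ?thesis using p by (simp add: shift_def shift_list_null)
  next
    case True
    have "shift_list (\<lambda>_. 0) as (\<lambda>bs. f (x, bs)) = 0"
    proof (rule shift_list_zeroI)
      fix bs assume "linked (\<lambda>_. 0::'a) as bs"
      then have "as = bs"
        unfolding linked_def by (induction as bs rule: list_all2_induct) (auto simp: mat_def split: if_splits)
      then show "f (x, bs) = 0" using True p by simp
    qed
    then show ?thesis using True p by (simp add: shift_def)
  qed
qed

section \<open>Effect of substitutions on paths of length two and on ideals\<close>

lemma shift_basis_elt2:
  assumes "e \<in> arrs Q" "e' \<in> arrs Q"
  shows "shift l (basis_elt (x, [e, e'])) (y, as) =
    (if y = x \<and> length as = 2 then mat l e (as ! 0) * mat l e' (as ! 1) else 0)"
proof (cases "length as = 2")
  case False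
  have "shift_list l as (\<lambda>bs. basis_elt (x, [e, e']) (y, bs)) = 0"
    by (rule shift_list_zeroI) (use False in \<open>auto simp: basis_elt_def dest: linked_length\<close>)
  then show ?thesis using False by (simp add: shift_def)
next
  case True
  then obtain a a' where as: "as = [a, a']" by (auto simp: numeral_2_eq_2 length_Suc_conv)
  have "shift_list l [a, a'] (\<lambda>bs. basis_elt (x, [e, e']) (y, bs)) =
    (\<Sum>b\<in>arrs Q. if e = b then mat l b a * (\<Sum>b'\<in>arrs Q. if e' = b' then mat l b' a' * (if y = x then 1 else 0) else 0) else 0)"
    unfolding shift_list.simps by (intro sum.cong refl) (auto simp: basis_elt_def if_distrib[of "(*) _"] intro!: sum.cong cong: if_cong)
  then show ?thesis using assms by (simp add: shift_def as sum.delta')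
qed

lemma shift_basis_elt2_fixed:
  assumes "e \<in> arrs Q" "e' \<in> arrs Q" "l e = 0" "l e' = 0"
  shows "shift l (basis_elt (x, [e, e'])) = basis_elt (x, [e, e'])"
proof
  fix p :: path
  obtain y as where "p = (y, as)" by (cases p)
  then show "shift l (basis_elt (x, [e, e'])) p = basis_elt (x, [e, e']) p"
    using assms shift_basis_elt2[of e e' l x y as]
    by (auto simp: basis_elt_def mat_def numeral_2_eq_2 length_Suc_conv)
qed

text \<open>The substitution is invertible, with inverse parameter \<open>- l\<close>. An outside
  factor \<open>f\<close> is pulled back along the inverse, multiplied inside \<open>I\<close>, and
  pushed forward again.\<close>

lemma pa_ideal_shift:
  assumes I: "pa_ideal Q I" and l: "\<And>a. a \<in> arrs Q \<Longrightarrow> l (base a) = 0"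
  shows "pa_ideal Q (shift l ` I)"
proof -
  have sub: "I \<subseteq> path_alg Q" using I by (simp add: pa_ideal_def)
  have inv: "f = shift l (shift (\<lambda>e. - l e) f)" if "f \<in> path_alg Q" for f
    using that by (simp add: shift_shift l shift_null)
  have mult: "pa_mult Q f (shift l a) \<in> shift l ` I" "pa_mult Q (shift l a) f \<in> shift l ` I"
    if "a \<in> I" "f \<in> path_alg Q" for a f
  proof -
    let ?f = "shift (\<lambda>e. - l e) f"
    have "pa_mult Q ?f a \<in> I" "pa_mult Q a ?f \<in> I"
      using I that(1) shift_in_path_alg[OF that(2)] unfolding pa_ideal_def by blast+
    then have "shift l (pa_mult Q ?f a) \<in> shift l ` I" "shift l (pa_mult Q a ?f) \<in> shift l ` I" by auto
    then show "pa_mult Q f (shift l a) \<in> shift l ` I" "pa_mult Q (shift l a) f \<in> shift l ` I"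
      using inv[OF that(2)] by (simp_all add: shift_mult)
  qed
  have sub': "shift l ` I \<subseteq> path_alg Q" using sub shift_in_path_alg by auto
  have zero: "(\<lambda>_. 0) \<in> shift l ` I"
    using I shift_zero[of l] by (auto simp: pa_ideal_def image_iff intro!: bexI[of _ "\<lambda>_. 0"])
  have add: "pa_add (shift l a) (shift l b) \<in> shift l ` I" if "a \<in> I" "b \<in> I" for a b
    using I that unfolding shift_add[symmetric] by (auto simp: pa_ideal_def)
  have smult: "pa_smult c (shift l a) \<in> shift l ` I" if "a \<in> I" for a c
    using I that unfolding shift_smult[symmetric] by (auto simp: pa_ideal_def)
  show ?thesis unfolding pa_ideal_def
    by (intro conjI ballI allI sub' zero) (auto simp only: mult add smult)
qed

lemma shift_image_iff:
  assumes "I \<subseteq> path_alg Q" "f \<in> path_alg Q" and l: "\<And>a. a \<in> arrs Q \<Longrightarrow> l (base a) = 0"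
  shows "f \<in> shift l ` I \<longleftrightarrow> shift (\<lambda>e. - l e) f \<in> I"
proof
  assume "f \<in> shift l ` I"
  then show "shift (\<lambda>e. - l e) f \<in> I"
    using assms by (auto simp: shift_shift shift_null subset_iff)
next
  assume "shift (\<lambda>e. - l e) f \<in> I"
  moreover have "f = shift l (shift (\<lambda>e. - l e) f)"
    using assms by (simp add: shift_shift shift_null)
  ultimately show "f \<in> shift l ` I" by blast
qed

text \<open>The lift is the substitution with parameter \<open>m - l\<close>, which carries the
  first ideal onto the second. It is an honest automorphism of the path algebra, so the algebra laws
  required modulo the ideal hold exactly.\<close>

lemma quotients_iso_shift:
  assumes I: "pa_ideal Q I"
    and l: "\<And>a. a \<in> arrs Q \<Longrightarrow> l (base a) = 0" and m: "\<And>a. a \<in> arrs Q \<Longrightarrow> m (base a) = 0"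
  shows "quotients_iso Q (shift l ` I) (shift m ` I)"
proof -
  have sub: "I \<subseteq> path_alg Q" and zero: "(\<lambda>_. 0) \<in> I" using I by (auto simp: pa_ideal_def)
  let ?h = "\<lambda>e. m e - l e"
  have zero': "(\<lambda>_. 0) \<in> shift m ` I"
    using zero shift_zero[of m] by (auto simp: image_iff intro!: bexI[of _ "\<lambda>_. 0"])
  have self: "pa_diff f f \<in> shift m ` I" for f :: "path \<Rightarrow> 'a"
    using zero' by (simp add: pa_diff_def)
  have "shift m ` I = shift ?h ` shift l ` I"
    unfolding image_image using l m by (simp add: shift_shift)
  moreover have "shift l ` I \<subseteq> path_alg Q" using sub shift_in_path_alg by auto
  ultimately have iff: "f \<in> shift l ` I \<longleftrightarrow> shift ?h f \<in> shift m ` I" if "f \<in> path_alg Q" for f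
    using that shift_image_iff[of "shift l ` I" "shift ?h f" ?h] l m
    by (simp add: shift_shift shift_null shift_in_path_alg)
  show ?thesis
    unfolding quotients_iso_def
  proof (intro exI[of _ "shift ?h"] conjI ballI allI)
    fix c :: "path \<Rightarrow> 'a" assume c: "c \<in> path_alg Q"
    then have "shift ?h (shift (\<lambda>e. - ?h e) c) = c"
      using l m by (simp add: shift_shift shift_null)
    then show "\<exists>a\<in>path_alg Q. pa_diff (shift ?h a) c \<in> shift m ` I"
      using c self by (intro bexI[of _ "shift (\<lambda>e. - ?h e) c"]) (auto intro: shift_in_path_alg)
  qed (auto simp: shift_in_path_alg self shift_add shift_smult shift_mult shift_one iff
      pa_diff_in_path_alg simp flip: shift_diff)
qed

text \<open>Substitution mixes only linked paths; if the grading is constant along links, it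
  preserves degrees and hence commutes with taking a homogeneous component.\<close>

lemma shift_component:
  assumes "\<And>x as bs. linked l as bs \<Longrightarrow> D (x, as) = D (x, bs)"
  shows "shift l (\<lambda>p. if D p = g then f p else 0) = (\<lambda>p. if D p = g then shift l f p else 0)"
proof
  fix p :: path
  obtain x as where p: "p = (x, as)" by (cases p)
  have "shift_list l as (\<lambda>bs. if D (x, bs) = g then f (x, bs) else 0) =
      shift_list l as (\<lambda>bs. if D (x, as) = g then f (x, bs) else 0)"
    by (rule shift_list_cong) (use assms in simp)
  then show "shift l (\<lambda>p. if D p = g then f p else 0) p = (if D p = g then shift l f p else 0)"
    by (simp add: p shift_def)
qed

lemma shift_basis_elt2_left:
  assumes "e \<in> arrs Q" "e' \<in> arrs Q" "l e' = 0"
  shows "shift l (basis_elt (x, [e, e'])) =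
    pa_add (basis_elt (x, [e, e'])) (pa_smult (l e) (basis_elt (x, [base e, e'])))"
proof
  fix p :: path
  obtain y as where p: "p = (y, as)" by (cases p)
  show "shift l (basis_elt (x, [e, e'])) p =
      pa_add (basis_elt (x, [e, e'])) (pa_smult (l e) (basis_elt (x, [base e, e']))) p"
    unfolding p shift_basis_elt2[OF assms(1,2)]
    by (auto simp: assms(3) pa_add_def pa_smult_def basis_elt_def mat_def numeral_2_eq_2 length_Suc_conv)
qed

lemma shift_basis_elt2_right:
  assumes "e \<in> arrs Q" "e' \<in> arrs Q" "l e = 0"
  shows "shift l (basis_elt (x, [e, e'])) =
    pa_add (basis_elt (x, [e, e'])) (pa_smult (l e') (basis_elt (x, [e, base e'])))"
proof
  fix p :: path
  obtain y as where p: "p = (y, as)" by (cases p)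
  show "shift l (basis_elt (x, [e, e'])) p =
      pa_add (basis_elt (x, [e, e'])) (pa_smult (l e') (basis_elt (x, [e, base e']))) p"
    unfolding p shift_basis_elt2[OF assms(1,2)]
    by (auto simp: assms(3) pa_add_def pa_smult_def basis_elt_def mat_def numeral_2_eq_2 length_Suc_conv)
qed

end

section \<open>Admissible ideals spanned by paths of length two\<close>

lemma pa_mult_nonzeroE:
  assumes "pa_mult Q f g (x, as) \<noteq> 0"
  obtains i where "i \<le> length as" "f (x, take i as) \<noteq> 0" "g (path_end Q (x, take i as), drop i as) \<noteq> 0"
    "is_path Q (x, as)"
proof -
  have path: "is_path Q (x, as)" using assms by (auto simp: pa_mult_def split: if_splits)
  then have "(\<Sum>i=0..length as. f (x, take i as) * g (path_end Q (x, take i as), drop i as)) \<noteq> 0"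
    using assms by (simp add: pa_mult_def)
  then obtain i where "i \<in> {0..length as}" "f (x, take i as) * g (path_end Q (x, take i as), drop i as) \<noteq> 0"
    by (meson sum.neutral)
  then show ?thesis using that path by auto
qed

lemma pa_mult_in_path_alg:
  assumes "f \<in> path_alg Q" "g \<in> path_alg Q"
  shows "pa_mult Q f g \<in> path_alg Q"
proof -
  have "{p. pa_mult Q f g p \<noteq> 0} \<subseteq>
      (\<lambda>(p, q). (fst p, snd p @ snd q)) ` ({p. f p \<noteq> 0} \<times> {p. g p \<noteq> 0})"
  proof
    fix p assume p: "p \<in> {p. pa_mult Q f g p \<noteq> 0}"
    obtain x as where xas: "p = (x, as)" by (cases p)
    with p obtain i where "f (x, take i as) \<noteq> 0" "g (path_end Q (x, take i as), drop i as) \<noteq> 0"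
      by (auto elim: pa_mult_nonzeroE)
    then show "p \<in> (\<lambda>(p, q). (fst p, snd p @ snd q)) ` ({p. f p \<noteq> 0} \<times> {p. g p \<noteq> 0})"
      by (intro image_eqI[of _ _ "((x, take i as), (path_end Q (x, take i as), drop i as))"])
        (simp_all add: xas)
  qed
  moreover have "finite \<dots>" using assms by (simp add: path_alg_def)
  ultimately have "finite {p. pa_mult Q f g p \<noteq> 0}" by (rule finite_subset)
  moreover have "is_path Q p" if "pa_mult Q f g p \<noteq> 0" for p
    using that by (cases p) (auto elim: pa_mult_nonzeroE)
  ultimately show ?thesis by (simp add: path_alg_def)
qed

text \<open>An upper bound for the \<open>m\<close>-th power of the arrow ideal that is described by
  supports, so that generated ideals need not be computed.\<close>

definition long_elts :: "quiver \<Rightarrow> nat \<Rightarrow> (path \<Rightarrow> 'k::field) set" where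
  "long_elts Q m = {f \<in> path_alg Q. \<forall>p. f p \<noteq> 0 \<longrightarrow> m \<le> length (snd p)}"

lemma pa_ideal_long_elts: "pa_ideal Q (long_elts Q m :: (path \<Rightarrow> 'k::field) set)"
proof -
  have mult: "pa_mult Q f a \<in> long_elts Q m" "pa_mult Q a f \<in> long_elts Q m"
    if "a \<in> long_elts Q m" "f \<in> path_alg Q" for a f :: "path \<Rightarrow> 'k"
  proof -
    have long: "m \<le> length bs" if "a (x, bs) \<noteq> 0" for x bs
      using \<open>a \<in> long_elts Q m\<close> that by (fastforce simp: long_elts_def)
    have "a \<in> path_alg Q" using that by (simp add: long_elts_def)
    then show "pa_mult Q f a \<in> long_elts Q m" "pa_mult Q a f \<in> long_elts Q m"
      using that(2) unfolding long_elts_def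
      by (auto intro!: pa_mult_in_path_alg elim!: pa_mult_nonzeroE dest!: long)
  qed
  have add: "pa_add a b \<in> long_elts Q m" if "a \<in> long_elts Q m" "b \<in> long_elts Q m" for a b :: "path \<Rightarrow> 'k"
  proof -
    have "m \<le> length (snd p)" if "pa_add a b p \<noteq> 0" for p
    proof (cases "a p = 0")
      case True
      then have "b p \<noteq> 0" using that by (simp add: pa_add_def)
      then show ?thesis using \<open>b \<in> long_elts Q m\<close> unfolding long_elts_def by blast
    next
      case False
      then show ?thesis using \<open>a \<in> long_elts Q m\<close> unfolding long_elts_def by blast
    qed
    then show ?thesis using that pa_add_in_path_alg unfolding long_elts_def by blast
  qed
  have smult: "pa_smult c a \<in> long_elts Q m" if "a \<in> long_elts Q m" for a :: "path \<Rightarrow> 'k" and c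
    using that pa_smult_in_path_alg[of a Q c] by (auto simp: long_elts_def pa_smult_def)
  have "(\<lambda>_. 0) \<in> long_elts Q m" "long_elts Q m \<subseteq> path_alg Q" by (auto simp: long_elts_def path_alg_def)
  then show ?thesis unfolding pa_ideal_def by (intro conjI ballI allI mult add smult)
qed

lemma long_elts_0: "long_elts Q 0 = path_alg Q"
  by (auto simp: long_elts_def)

lemma long_elts_mult:
  assumes "f \<in> long_elts Q m" "g \<in> long_elts Q m'"
  shows "pa_mult Q f g \<in> long_elts Q (m + m')"
proof -
  have "m + m' \<le> length (snd p)" if p: "pa_mult Q f g p \<noteq> 0" for p
  proof -
    obtain x as where xas: "p = (x, as)" by (cases p)
    from p xas obtain i where "i \<le> length as" "f (x, take i as) \<noteq> 0"
        "g (path_end Q (x, take i as), drop i as) \<noteq> 0" by (auto elim: pa_mult_nonzeroE)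
    then have "i \<le> length as" "m \<le> length (take i as)" "m' \<le> length (drop i as)"
      using assms unfolding long_elts_def by fastforce+
    then show ?thesis using xas by simp
  qed
  then show ?thesis using assms pa_mult_in_path_alg unfolding long_elts_def by blast
qed

section \<open>Powers of the arrow ideal\<close>

lemma gen_ideal_least: "pa_ideal Q I \<Longrightarrow> S \<subseteq> I \<Longrightarrow> gen_ideal Q S \<subseteq> I"
  by (auto simp: gen_ideal_def)

lemma gen_ideal_superset: "S \<subseteq> gen_ideal Q S"
  by (auto simp: gen_ideal_def)

lemma pa_ideal_gen_ideal:
  assumes "S \<subseteq> path_alg Q"
  shows "pa_ideal Q (gen_ideal Q S)"
proof -
  have "gen_ideal Q S \<subseteq> path_alg Q"
    using gen_ideal_least[OF pa_ideal_long_elts[of Q 0]] assms by (simp add: long_elts_0)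
  then show ?thesis unfolding pa_ideal_def by (auto simp: gen_ideal_def pa_ideal_def)
qed

lemma arrow_ideal_long:
  assumes "finite_quiver Q"
  shows "arrow_ideal Q \<subseteq> (long_elts Q 1 :: (path \<Rightarrow> 'k::field) set)"
  unfolding arrow_ideal_def
proof (rule gen_ideal_least[OF pa_ideal_long_elts], clarify)
  fix a assume "a \<in> arrs Q"
  then show "arrow_elt Q a \<in> (long_elts Q 1 :: (path \<Rightarrow> 'k) set)"
    using assms by (auto simp: long_elts_def path_alg_def arrow_elt_def is_path_def fwd_def finite_quiver_def)
qed

lemma ideal_power_long:
  assumes "finite_quiver Q"
  shows "ideal_power Q (arrow_ideal Q) m \<subseteq> (long_elts Q m :: (path \<Rightarrow> 'k::field) set)"
proof (induction m)
  case (Suc m)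
  have "{pa_mult Q a b |a b. a \<in> ideal_power Q (arrow_ideal Q) m \<and> b \<in> arrow_ideal Q} \<subseteq>
      (long_elts Q (Suc m) :: (path \<Rightarrow> 'k) set)"
    using long_elts_mult[of _ Q m _ 1] Suc arrow_ideal_long[OF assms] by fastforce
  then show ?case by (simp add: gen_ideal_least[OF pa_ideal_long_elts])
qed (simp add: long_elts_0)

lemma pa_ideal_ideal_power:
  assumes "finite_quiver Q"
  shows "pa_ideal Q (ideal_power Q (arrow_ideal Q) m :: (path \<Rightarrow> 'k::field) set)"
proof (cases m)
  case 0
  then show ?thesis using pa_ideal_long_elts[of Q 0] by (simp add: long_elts_0)
next
  case (Suc m')
  have "ideal_power Q (arrow_ideal Q) m' \<subseteq> (path_alg Q :: (path \<Rightarrow> 'k) set)"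
    "arrow_ideal Q \<subseteq> (path_alg Q :: (path \<Rightarrow> 'k) set)"
    using ideal_power_long[OF assms, of m'] arrow_ideal_long[OF assms] by (auto simp: long_elts_def)
  then show ?thesis
    unfolding Suc ideal_power.simps by (intro pa_ideal_gen_ideal) (auto intro!: pa_mult_in_path_alg)
qed

lemma basis_elt_mult:
  assumes "is_path Q (x, as @ bs)" "path_end Q (x, as) = y"
  shows "pa_mult Q (basis_elt (x, as)) (basis_elt (y, bs)) = (basis_elt (x, as @ bs) :: path \<Rightarrow> 'k::field)"
proof
  fix p :: path
  obtain z cs where p: "p = (z, cs)" by (cases p)
  show "pa_mult Q (basis_elt (x, as)) (basis_elt (y, bs)) p = (basis_elt (x, as @ bs) p :: 'k)"
  proof (cases "p = (x, as @ bs)")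
    case True
    \<comment> \<open>Only the cut at \<open>length as\<close> can contribute, because the other
      initial segments have the wrong length.\<close>
    have "take i (as @ bs) \<noteq> as" if "i \<le> length (as @ bs)" "i \<noteq> length as" for i
      using that by (metis length_take min.absorb2)
    then have "(\<Sum>i=0..length (as @ bs). basis_elt (x, as) (x, take i (as @ bs)) *
          basis_elt (y, bs) (path_end Q (x, take i (as @ bs)), drop i (as @ bs))) =
        (\<Sum>i=0..length (as @ bs). if i = length as then 1 else (0::'k))"
      using assms(2) by (intro sum.cong refl) (auto simp: basis_elt_def)
    then have "pa_mult Q (basis_elt (x, as)) (basis_elt (y, bs)) p =
        (\<Sum>i=0..length (as @ bs). if i = length as then 1 else (0::'k))"
      unfolding True pa_mult_def using assms(1) by simp
    then show ?thesis using True by (simp add: basis_elt_def)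
  next
    case False
    have "pa_mult Q (basis_elt (x, as)) (basis_elt (y, bs)) p = (0::'k)"
    proof (rule ccontr)
      assume "pa_mult Q (basis_elt (x, as)) (basis_elt (y, bs)) p \<noteq> (0::'k)"
      then obtain i where "basis_elt (x, as) (z, take i cs) \<noteq> (0::'k)"
          "basis_elt (y, bs) (path_end Q (z, take i cs), drop i cs) \<noteq> (0::'k)"
        unfolding p by (rule pa_mult_nonzeroE)
      then have "z = x" "take i cs = as" "drop i cs = bs" by (auto simp: basis_elt_def split: if_splits)
      then show False using False p by (metis append_take_drop_id)
    qed
    then show ?thesis using False by (simp add: basis_elt_def)
  qed
qed

lemma arrow_elt_conv: "arrow_elt Q a = basis_elt (src Q a, [a])"
  by (simp add: arrow_elt_def basis_elt_def)

text \<open>The zeroth power is the whole path algebra, so the first arrow enters the first power as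
  the product of the stationary path at its source with itself. Multiplying by the second arrow then
  reaches the second power.\<close>

lemma basis_elt_in_ideal_power_2:
  assumes Q: "finite_quiver Q" and path: "is_path Q (x, [a, b])"
  shows "(basis_elt (x, [a, b]) :: path \<Rightarrow> 'k::field) \<in> ideal_power Q (arrow_ideal Q) 2"
proof -
  have ab: "a \<in> arrs Q" "b \<in> arrs Q" "src Q a = x" "tgt Q a = src Q b" "x \<in> verts Q" "src Q b \<in> verts Q"
    using path Q by (auto simp: is_path_def fwd_def finite_quiver_def split: if_splits)
  have arr: "(basis_elt (src Q c, [c]) :: path \<Rightarrow> 'k) \<in> arrow_ideal Q" if "c \<in> arrs Q" for c
    using gen_ideal_superset[of "arrow_elt Q ` arrs Q :: (path \<Rightarrow> 'k) set" Q] that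
    unfolding arrow_ideal_def arrow_elt_conv by auto
  have path_a: "is_path Q (x, [a])" using ab Q by (auto simp: is_path_def fwd_def finite_quiver_def)
  have "pa_mult Q (basis_elt (x, [])) (basis_elt (x, [a])) = (basis_elt (x, [a]) :: path \<Rightarrow> 'k)"
    using basis_elt_mult[of Q x "[]" "[a]" x] path_a ab by (simp add: path_end_def fwd_def)
  moreover have "(basis_elt (x, []) :: path \<Rightarrow> 'k) \<in> path_alg Q"
    using ab by (intro basis_elt_in_path_alg) (simp add: is_path_def fwd_def)
  ultimately have "(basis_elt (x, [a]) :: path \<Rightarrow> 'k) \<in>
      {pa_mult Q f g |f g. f \<in> path_alg Q \<and> g \<in> arrow_ideal Q}"
    using arr[of a] ab by force
  then have 1: "(basis_elt (x, [a]) :: path \<Rightarrow> 'k) \<in> ideal_power Q (arrow_ideal Q) 1"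
    unfolding One_nat_def ideal_power.simps by (rule subsetD[OF gen_ideal_superset])
  have "pa_mult Q (basis_elt (x, [a])) (basis_elt (src Q b, [b])) = (basis_elt (x, [a, b]) :: path \<Rightarrow> 'k)"
    using basis_elt_mult[of Q x "[a]" "[b]" "src Q b"] path ab by (simp add: path_end_def fwd_def)
  then have "(basis_elt (x, [a, b]) :: path \<Rightarrow> 'k) \<in>
      {pa_mult Q f g |f g. f \<in> ideal_power Q (arrow_ideal Q) 1 \<and> g \<in> arrow_ideal Q}"
    using arr[of b] ab 1 by force
  then show ?thesis
    unfolding numeral_2_eq_2 One_nat_def ideal_power.simps(2)[of _ _ "Suc 0"]
    by (rule subsetD[OF gen_ideal_superset])
qed

lemma pa_ideal_contains:
  assumes J: "pa_ideal Q J" and "finite A" "\<And>p. p \<in> A \<Longrightarrow> basis_elt p \<in> J" "\<And>p. f p \<noteq> 0 \<Longrightarrow> p \<in> A"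
  shows "f \<in> J"
  using assms(2-)
proof (induction A arbitrary: f rule: finite_induct)
  case empty
  then have "f = (\<lambda>_. 0)" by (intro ext) blast
  then show ?case using J by (simp add: pa_ideal_def)
next
  case (insert p A)
  have "f(p := 0) \<in> J"
  proof (rule insert.IH)
    fix q assume "(f(p := 0)) q \<noteq> 0"
    then have "q \<noteq> p" "f q \<noteq> 0" by (auto split: if_splits)
    then show "q \<in> A" using insert.prems(2)[of q] by simp
  qed (use insert.prems(1) in simp)
  moreover have "pa_smult (f p) (basis_elt p) \<in> J" using J insert.prems by (auto simp: pa_ideal_def)
  ultimately have "pa_add (pa_smult (f p) (basis_elt p)) (f(p := 0)) \<in> J"
    using J by (simp add: pa_ideal_def)
  moreover have "pa_add (pa_smult (f p) (basis_elt p)) (f(p := 0)) = f"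
    by (auto simp: pa_add_def pa_smult_def basis_elt_def)
  ultimately show ?case by simp
qed

text \<open>Without paths of length three the third power of the arrow ideal is zero, which gives
  the exponent \<open>3\<close>. The other inclusion holds because every element is a combination of
  paths of length two, each lying in the second power.\<close>

lemma admissibleI:
  fixes I :: "(path \<Rightarrow> 'k::field) set"
  assumes Q: "finite_quiver Q" and I: "pa_ideal Q I"
    and len: "\<And>f p. f \<in> I \<Longrightarrow> f p \<noteq> 0 \<Longrightarrow> length (snd p) = 2"
    and short: "\<And>p. is_path Q p \<Longrightarrow> length (snd p) \<le> 2"
  shows "admissible Q I"
proof -
  have "f = (\<lambda>_. 0)" if "f \<in> long_elts Q 3" for f :: "path \<Rightarrow> 'k"
  proof
    fix p
    show "f p = 0"
    proof (rule ccontr)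
      assume "f p \<noteq> 0"
      then have "is_path Q p" "3 \<le> length (snd p)"
        using that unfolding long_elts_def path_alg_def by blast+
      then show False using short[of p] by simp
    qed
  qed
  then have "ideal_power Q (arrow_ideal Q) 3 \<subseteq> I"
    using ideal_power_long[OF Q, of 3] I by (force simp: pa_ideal_def)
  moreover have "I \<subseteq> ideal_power Q (arrow_ideal Q) 2"
  proof
    fix f assume f: "f \<in> I"
    then have alg: "f \<in> path_alg Q" using I by (auto simp: pa_ideal_def)
    show "f \<in> ideal_power Q (arrow_ideal Q) 2"
    proof (rule pa_ideal_contains[OF pa_ideal_ideal_power[OF Q], of "{p. f p \<noteq> 0}"])
      fix p assume p: "p \<in> {p. f p \<noteq> 0}"
      moreover obtain x as where xas: "p = (x, as)" by (cases p)
      ultimately obtain a b where "p = (x, [a, b])"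
        using len[OF f, of p] by (auto simp: numeral_2_eq_2 length_Suc_conv)
      then show "basis_elt p \<in> (ideal_power Q (arrow_ideal Q) 2 :: (path \<Rightarrow> 'k) set)"
        using basis_elt_in_ideal_power_2[OF Q, of x a b] p alg by (simp add: path_alg_def)
    qed (use alg in \<open>auto simp: path_alg_def\<close>)
  qed
  ultimately show ?thesis
    using I unfolding admissible_def by (intro conjI exI[of _ 3]) simp_all
qed

section \<open>Linear spans as ideals\<close>

inductive_set lin_span :: "(path \<Rightarrow> 'k::field) set \<Rightarrow> (path \<Rightarrow> 'k) set" for S where
  zero: "(\<lambda>_. 0) \<in> lin_span S"
| step: "f \<in> S \<Longrightarrow> h \<in> lin_span S \<Longrightarrow> pa_add (pa_smult c f) h \<in> lin_span S"

lemma lin_span_superset: "f \<in> S \<Longrightarrow> f \<in> lin_span S"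
  using lin_span.step[OF _ lin_span.zero, of f S 1] by (simp add: pa_add_def pa_smult_def)

lemma lin_span_add: "f \<in> lin_span S \<Longrightarrow> g \<in> lin_span S \<Longrightarrow> pa_add f g \<in> lin_span S"
proof (induction rule: lin_span.induct)
  case zero
  then show ?case by (simp add: pa_add_def)
next
  case (step f h c)
  have "pa_add (pa_add (pa_smult c f) h) g = pa_add (pa_smult c f) (pa_add h g)"
    by (simp add: pa_add_def add.assoc)
  then show ?case using step by (auto intro: lin_span.step)
qed

lemma lin_span_smult: "f \<in> lin_span S \<Longrightarrow> pa_smult d f \<in> lin_span S"
proof (induction rule: lin_span.induct)
  case zero
  then show ?case by (simp add: pa_smult_def lin_span.zero)
next
  case (step f h c)
  have "pa_smult d (pa_add (pa_smult c f) h) = pa_add (pa_smult (d * c) f) (pa_smult d h)"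
    by (simp add: pa_add_def pa_smult_def algebra_simps)
  then show ?case using step by (auto intro: lin_span.step)
qed

lemma pa_mult_add_left: "pa_mult Q (pa_add f g) h = pa_add (pa_mult Q f h) (pa_mult Q g h)"
  by (auto simp: pa_mult_def pa_add_def fun_eq_iff algebra_simps sum.distrib)

lemma pa_mult_add_right: "pa_mult Q h (pa_add f g) = pa_add (pa_mult Q h f) (pa_mult Q h g)"
  by (auto simp: pa_mult_def pa_add_def fun_eq_iff algebra_simps sum.distrib)

lemma pa_mult_smult_left: "pa_mult Q (pa_smult c f) h = pa_smult c (pa_mult Q f h)"
  by (auto simp: pa_mult_def pa_smult_def fun_eq_iff algebra_simps sum_distrib_left)

lemma pa_mult_smult_right: "pa_mult Q h (pa_smult c f) = pa_smult c (pa_mult Q h f)"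
  by (auto simp: pa_mult_def pa_smult_def fun_eq_iff algebra_simps sum_distrib_left)

text \<open>When no path is longer than 2, multiplication by an algebra element only rescales
  a combination of parallel paths of length 2, so every span of such combinations is an ideal.\<close>

lemma pa_mult_top_left:
  assumes short: "\<And>p. is_path Q p \<Longrightarrow> length (snd p) \<le> 2"
    and g: "\<And>p. g p \<noteq> 0 \<Longrightarrow> is_path Q p \<and> length (snd p) = 2 \<and> fst p = x"
  shows "pa_mult Q f g = pa_smult (f (x, [])) g"
proof
  fix p :: path
  obtain z as where p: "p = (z, as)" by (cases p)
  show "pa_mult Q f g p = pa_smult (f (x, [])) g p"
  proof (cases "is_path Q p")
    case False
    then show ?thesis using g[of p] p by (auto simp: pa_mult_def pa_smult_def)
  next
    case True
    have zero: "g (path_end Q (z, take i as), drop i as) = 0" if "i \<in> {0..length as}" "i \<noteq> 0" for i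
    proof (rule ccontr)
      assume "g (path_end Q (z, take i as), drop i as) \<noteq> 0"
      from g[OF this] have "length as - i = 2" by simp
      then show False using that short[OF True] p by simp
    qed
    have "pa_mult Q f g p = (\<Sum>i\<in>{0..length as}. f (z, take i as) * g (path_end Q (z, take i as), drop i as))"
      using True p by (simp add: pa_mult_def)
    also have "\<dots> = (\<Sum>i\<in>{0..length as}. if i = 0 then f (z, []) * g (path_end Q (z, []), as) else 0)"
      using zero by (intro sum.cong) auto
    also have "\<dots> = f (z, []) * g (path_end Q (z, []), as)" by simp
    also have "path_end Q (z, []) = z"
      using True p by (cases as) (auto simp: path_end_def fwd_def is_path_def split: if_splits)
    finally show ?thesis using p g[of p] by (cases "g p = 0") (auto simp: pa_smult_def)
  qed
qed

lemma pa_mult_top_right: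
  assumes short: "\<And>p. is_path Q p \<Longrightarrow> length (snd p) \<le> 2"
    and g: "\<And>p. g p \<noteq> 0 \<Longrightarrow> is_path Q p \<and> length (snd p) = 2 \<and> path_end Q p = y"
  shows "pa_mult Q g f = pa_smult (f (y, [])) g"
proof
  fix p :: path
  obtain z as where p: "p = (z, as)" by (cases p)
  show "pa_mult Q g f p = pa_smult (f (y, [])) g p"
  proof (cases "is_path Q p")
    case False
    then show ?thesis using g[of p] p by (auto simp: pa_mult_def pa_smult_def)
  next
    case True
    have zero: "g (z, take i as) = 0" if "i \<in> {0..length as}" "i \<noteq> length as" for i
    proof (rule ccontr)
      assume "g (z, take i as) \<noteq> 0"
      from g[OF this] have "min (length as) i = 2" by simp
      then show False using that short[OF True] p by simp
    qed
    have "pa_mult Q g f p = (\<Sum>i\<in>{0..length as}. g (z, take i as) * f (path_end Q (z, take i as), drop i as))"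
      using True p by (simp add: pa_mult_def)
    also have "\<dots> = (\<Sum>i\<in>{0..length as}. if i = length as then g (z, as) * f (path_end Q (z, as), []) else 0)"
      using zero by (intro sum.cong) auto
    also have "\<dots> = g (z, as) * f (path_end Q (z, as), [])" by simp
    finally show ?thesis using p g[of p] by (cases "g p = 0") (auto simp: pa_smult_def)
  qed
qed

lemma lin_span_in_path_alg:
  assumes "S \<subseteq> path_alg Q"
  shows "lin_span S \<subseteq> path_alg Q"
proof
  fix f assume "f \<in> lin_span S"
  then show "f \<in> path_alg Q"
  proof (induction rule: lin_span.induct)
    case zero
    then show ?case by (simp add: path_alg_def)
  next
    case (step f h c)
    then show ?case using assms by (auto intro!: pa_add_in_path_alg pa_smult_in_path_alg)
  qed
qed

lemma pa_ideal_lin_span: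
  fixes S :: "(path \<Rightarrow> 'k::field) set"
  assumes short: "\<And>p. is_path Q p \<Longrightarrow> length (snd p) \<le> 2"
    and S: "S \<subseteq> path_alg Q"
    and par: "\<And>f. f \<in> S \<Longrightarrow> \<exists>x y. \<forall>p. f p \<noteq> 0 \<longrightarrow> length (snd p) = 2 \<and> fst p = x \<and> path_end Q p = y"
  shows "pa_ideal Q (lin_span S)"
proof -
  have gen: "\<exists>c. pa_mult Q f a = pa_smult c a" "\<exists>c. pa_mult Q a f = pa_smult c a"
    if a: "a \<in> S" for a f :: "path \<Rightarrow> 'k"
  proof -
    obtain x y where "\<forall>p. a p \<noteq> 0 \<longrightarrow> length (snd p) = 2 \<and> fst p = x \<and> path_end Q p = y"
      using par[OF a] by blast
    moreover have "\<forall>p. a p \<noteq> 0 \<longrightarrow> is_path Q p" using S a by (auto simp: path_alg_def)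
    ultimately show "\<exists>c. pa_mult Q f a = pa_smult c a" "\<exists>c. pa_mult Q a f = pa_smult c a"
      using pa_mult_top_left[OF short, where g = a and x = x] pa_mult_top_right[OF short, where g = a and y = y]
      by blast+
  qed
  have "pa_mult Q f a \<in> lin_span S \<and> pa_mult Q a f \<in> lin_span S" if "a \<in> lin_span S" for a f
    using that
  proof (induction rule: lin_span.induct)
    case zero
    have "pa_mult Q f (\<lambda>_. 0) = (\<lambda>_. 0)" "pa_mult Q (\<lambda>_. 0) f = (\<lambda>_. 0)"
      by (auto simp: pa_mult_def)
    then show ?case by (simp add: lin_span.zero)
  next
    case (step a h c)
    obtain d e where "pa_mult Q f a = pa_smult d a" "pa_mult Q a f = pa_smult e a"
      using gen[OF step(1)] by blast
    then show ?case
      using step by (simp add: pa_mult_add_left pa_mult_add_right pa_mult_smult_left pa_mult_smult_right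
          lin_span_add lin_span_smult lin_span_superset)
  qed
  then show ?thesis
    unfolding pa_ideal_def
    by (intro conjI ballI allI lin_span_in_path_alg[OF S] lin_span.zero lin_span_add lin_span_smult) blast+
qed

text \<open>A proper nonempty part of a binomial is a multiple of one of its two paths, so excluding
  both paths from the ideal gives minimality. The case \<open>p = q\<close> is separate, since the
  difference is then zero and not a relation with two terms.\<close>

lemma htpy_binomial:
  assumes I: "pa_ideal Q I" and pq: "fst p = fst q" "path_end Q p = path_end Q q"
    and path: "is_path Q p"
    and rel: "pa_diff (basis_elt p) (basis_elt q) \<in> I"
    and notin: "basis_elt p \<notin> I" "basis_elt q \<notin> I"
  shows "htpy Q I (fst p, fwd (snd p)) (fst q, fwd (snd q))"
proof (cases "p = q")
  case True
  then show ?thesis using path by (auto intro: h_refl simp: is_path_def)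
next
  case False
  let ?r = "pa_diff (basis_elt p) (basis_elt q) :: path \<Rightarrow> 'a"
  have supp: "supp ?r = {p, q}"
    using False by (auto simp: supp_def pa_diff_def basis_elt_def)
  have "(\<lambda>r. if r \<in> K then ?r r else 0) \<notin> I" if "K \<subset> supp ?r" "K \<noteq> {}" for K
  proof -
    have "K = {p} \<or> K = {q}" using that unfolding supp by blast
    then show ?thesis
    proof
      assume "K = {p}"
      then have "(\<lambda>r. if r \<in> K then ?r r else 0) = basis_elt p"
        using False by (auto simp: pa_diff_def basis_elt_def)
      then show ?thesis using notin by simp
    next
      assume K: "K = {q}"
      then have eq: "basis_elt q = pa_smult (- 1) (\<lambda>r. if r \<in> K then ?r r else 0)"
        using False by (auto simp: pa_diff_def basis_elt_def pa_smult_def)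
      have neg: "pa_smult (- 1) f \<in> I" if "f \<in> I" for f using I that unfolding pa_ideal_def by blast
      show ?thesis
      proof
        assume "(\<lambda>r. if r \<in> K then ?r r else 0) \<in> I"
        then have "basis_elt q \<in> I" by (subst eq) (rule neg)
        then show False using notin by simp
      qed
    qed
  qed
  then have "minimal_relation Q I ?r"
    using rel pq False unfolding minimal_relation_def supp by auto
  then show ?thesis using supp by (auto intro: h_rel)
qed

text \<open>The component of degree \<open>D p\<close> is a nonempty subsum lying in the ideal. If
  \<open>q\<close> had another degree, this subsum would be proper, against minimality.\<close>

lemma minimal_relation_homogeneous:
  assumes graded: "\<And>f g. f \<in> I \<Longrightarrow> (\<lambda>p. if D p = g then f p else 0) \<in> I"
    and min: "minimal_relation Q I r" and pq: "p \<in> supp r" "q \<in> supp r"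
  shows "D p = D q"
proof (rule ccontr)
  assume neq: "D p \<noteq> D q"
  let ?K = "{s \<in> supp r. D s = D p}"
  have "q \<notin> ?K" "p \<in> ?K" using pq neq by auto
  then have "?K \<subset> supp r" "?K \<noteq> {}" using pq by blast+
  then have "(\<lambda>s. if s \<in> ?K then r s else 0) \<notin> I" using min unfolding minimal_relation_def by blast
  moreover have "(\<lambda>s. if s \<in> ?K then r s else 0) = (\<lambda>s. if D s = D p then r s else 0)"
    by (auto simp: supp_def)
  moreover have "r \<in> I" using min by (simp add: minimal_relation_def)
  ultimately show False using graded by simp
qed

section \<open>Homotopy of walks\<close>

text \<open>The delicate case is a minimal relation: as the ideal lies in the path algebra, its
  terms are genuine paths, so equality of \<open>path_end\<close> is equality of actual end vertices
  and not of unspecified values.\<close>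

lemma htpy_walk:
  assumes Q: "finite_quiver Q" and I: "I \<subseteq> path_alg Q"
  shows "htpy Q I u v \<Longrightarrow> fst u = fst v \<and> walk_end Q (fst u) (snd u) = walk_end Q (fst v) (snd v) \<and>
    walk_end Q (fst u) (snd u) \<noteq> None"
proof (induction rule: htpy.induct)
  case (h_rel \<rho> p q)
  have "\<rho> \<in> path_alg Q" using h_rel I by (auto simp: minimal_relation_def)
  then have "is_path Q p" "is_path Q q" using h_rel(2,3) unfolding path_alg_def supp_def by blast+
  moreover have "fst p = fst q" "path_end Q p = path_end Q q"
    using h_rel unfolding minimal_relation_def by metis+
  ultimately show ?case by (auto simp: is_path_def path_end_def)
next
  case (h_ctx x u v z w w')
  then show ?case by (auto simp: walk_end_append split: option.splits)
qed (use Q in \<open>auto simp: finite_quiver_def\<close>)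

locale bound_quiver =
  fixes Q :: quiver and I :: "(path \<Rightarrow> 'k::field) set"
  assumes finite_Q: "finite_quiver Q" and I: "I \<subseteq> path_alg Q"
begin

section \<open>Cancellation in the groupoid of homotopy classes of walks\<close>

abbreviation homotopic :: "nat \<Rightarrow> (nat \<times> bool) list \<Rightarrow> (nat \<times> bool) list \<Rightarrow> bool" where
  "homotopic x s t \<equiv> htpy Q I (x, s) (x, t)"

lemma homotopic_walk_end: "homotopic x s t \<Longrightarrow> walk_end Q x s = walk_end Q x t"
  using htpy_walk[OF finite_Q I] by fastforce

lemma homotopic_defined: "homotopic x s t \<Longrightarrow> walk_end Q x s \<noteq> None"
  using htpy_walk[OF finite_Q I] by fastforce

lemma homotopic_refl: "walk_end Q x s = Some y \<Longrightarrow> homotopic x s s"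
  by (rule h_refl) simp

lemma homotopic_append:
  assumes s: "homotopic x s s'" and t: "homotopic y t t'" and y: "walk_end Q x s = Some y"
  shows "homotopic x (s @ t) (s' @ t')"
proof -
  have x: "walk_end Q x [] = Some x" using walk_end_Some_start[OF y] by simp
  have y': "walk_end Q x s' = Some y" using homotopic_walk_end[OF s] y by simp
  have d: "walk_end Q x (s @ t) \<noteq> None" "walk_end Q x (s' @ t) \<noteq> None" "walk_end Q x (s' @ t') \<noteq> None"
    using y y' homotopic_defined[OF t] homotopic_walk_end[OF t] by (auto simp: walk_end_append)
  have "homotopic x ([] @ s @ t) ([] @ s' @ t)" by (rule h_ctx[OF s x]) (use d in auto)
  moreover have "homotopic x (s' @ t @ []) (s' @ t' @ [])" by (rule h_ctx[OF t y']) (use d in auto)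
  ultimately show ?thesis by (auto intro: h_trans)
qed

lemma homotopic_append_left:
  "homotopic y t t' \<Longrightarrow> walk_end Q x s = Some y \<Longrightarrow> homotopic x (s @ t) (s @ t')"
  by (auto intro: homotopic_append homotopic_refl)

lemma homotopic_append_right:
  "homotopic x s s' \<Longrightarrow> walk_end Q x s = Some y \<Longrightarrow> walk_end Q y t \<noteq> None \<Longrightarrow>
    homotopic x (s @ t) (s' @ t)"
  by (auto intro: homotopic_append homotopic_refl)

lemma homotopic_step_inverse:
  assumes "walk_end Q x [(a, d)] = Some y"
  shows "homotopic x [(a, d), (a, \<not> d)] []" "walk_end Q y [(a, \<not> d)] = Some x"
  using assms h_cancel1[of a Q I] h_cancel2[of a Q I] by (cases d; auto split: if_splits)+

lemma homotopic_cancel_left_step: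
  assumes "homotopic x (e # s) (e # t)" "walk_end Q x [e] = Some y"
  shows "homotopic y s t"
proof -
  obtain a d where e: "e = (a, d)" by (cases e)
  note inv = homotopic_step_inverse[of x a d y]
  have ret: "walk_end Q y [(a, \<not> d)] = Some x" using inv assms e by simp
  note inv' = homotopic_step_inverse[OF ret]
  have remove: "homotopic y ([(a, \<not> d)] @ e # r) r" if r: "walk_end Q x (e # r) \<noteq> None" for r
  proof -
    obtain z where "walk_end Q y r = Some z" using r assms(2) walk_end_append[of Q x "[e]" r] by auto
    then have "homotopic y ([(a, \<not> d), (a, \<not> \<not> d)] @ r) ([] @ r)"
      by (intro homotopic_append_right[OF inv'(1)]) (use assms(2) ret e walk_end_Some_start in \<open>auto split: if_splits\<close>)
    then show ?thesis using e by simp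
  qed
  have "homotopic y ([(a, \<not> d)] @ e # s) ([(a, \<not> d)] @ e # t)"
    by (rule homotopic_append_left[OF assms(1) ret])
  moreover have "walk_end Q x (e # s) \<noteq> None" "walk_end Q x (e # t) \<noteq> None"
    using homotopic_defined[OF assms(1)] homotopic_walk_end[OF assms(1)] by simp_all
  ultimately show ?thesis using remove by (meson h_sym h_trans)
qed

lemma homotopic_cancel_left:
  "homotopic x (r @ s) (r @ t) \<Longrightarrow> walk_end Q x r = Some y \<Longrightarrow> homotopic y s t"
proof (induction r arbitrary: x)
  case Nil
  then show ?case by (simp split: if_splits)
next
  case (Cons e r)
  have "walk_end Q x ([e] @ r) = Some y" using Cons.prems by simp
  then obtain z where z: "walk_end Q x [e] = Some z" "walk_end Q z r = Some y"
    unfolding walk_end_append by (auto split: option.splits)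
  then have "homotopic z (r @ s) (r @ t)"
    using homotopic_cancel_left_step[of x e "r @ s" "r @ t" z] Cons.prems by simp
  then show ?case using Cons.IH z by blast
qed

lemma homotopic_cancel_right_step:
  assumes h: "homotopic x (s @ [e]) (t @ [e])" and s: "walk_end Q x s = Some y" and t: "walk_end Q x t = Some y"
  shows "homotopic x s t"
proof -
  obtain a d where e: "e = (a, d)" by (cases e)
  obtain z where z: "walk_end Q y [e] = Some z"
    using homotopic_defined[OF h] s by (auto simp: walk_end_append)
  note inv = homotopic_step_inverse[of y a d z]
  have "homotopic x ((s @ [e]) @ [(a, \<not> d)]) ((t @ [e]) @ [(a, \<not> d)])"
  proof (rule homotopic_append_right[OF h])
    show "walk_end Q x (s @ [e]) = Some z" using s z by (simp add: walk_end_append del: walk_end.simps)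
    show "walk_end Q z [(a, \<not> d)] \<noteq> None" using inv(2) z e by (simp del: walk_end.simps)
  qed
  moreover have "homotopic x (r @ [(a, d), (a, \<not> d)]) (r @ [])" if "walk_end Q x r = Some y" for r
    by (rule homotopic_append_left) (use inv z e that in auto)
  ultimately show ?thesis using s t e by simp (meson h_sym h_trans)
qed

lemma homotopic_cancel_right:
  "homotopic x (s @ r) (t @ r) \<Longrightarrow> walk_end Q x s = Some y \<Longrightarrow> walk_end Q x t = Some y \<Longrightarrow>
    homotopic x s t"
proof (induction r arbitrary: s t y)
  case (Cons e r)
  have "walk_end Q x ((s @ [e]) @ r) \<noteq> None" using homotopic_defined[OF Cons.prems(1)] by simp
  then obtain z where z: "walk_end Q x (s @ [e]) = Some z" unfolding walk_end_append[of Q x "s @ [e]"]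
    by (auto split: option.splits)
  moreover have "walk_end Q x (t @ [e]) = Some z" using z Cons.prems by (simp add: walk_end_append)
  ultimately have "homotopic x (s @ [e]) (t @ [e])" using Cons.IH[of "s @ [e]" "t @ [e]" z] Cons.prems by simp
  then show ?case using Cons.prems homotopic_cancel_right_step by blast
qed simp

end

text \<open>The product of classes is defined through chosen representatives, so its independence of
  the choice must be shown. Compatibility with products is assumed for \<open>S\<close> only and is
  pulled back to \<open>R\<close> along \<open>f\<close>, which preserves and reflects equivalence.
  Surjectivity is needed only up to \<open>S\<close>.\<close>

lemma quot_monoid_iso:
  assumes reflR: "\<And>a. a \<in> D \<Longrightarrow> R a a"
    and symR: "\<And>a b. R a b \<Longrightarrow> R b a" and transR: "\<And>a b c. R a b \<Longrightarrow> R b c \<Longrightarrow> R a c"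
    and reflS: "\<And>a. a \<in> E \<Longrightarrow> S a a"
    and symS: "\<And>a b. S a b \<Longrightarrow> S b a" and transS: "\<And>a b c. S a b \<Longrightarrow> S b c \<Longrightarrow> S a c"
    and closed: "\<And>a b. a \<in> D \<Longrightarrow> b \<in> D \<Longrightarrow> app a b \<in> D"
    and congS: "\<And>a b a' b'. S a a' \<Longrightarrow> S b b' \<Longrightarrow> S (app' a b) (app' a' b')"
    and f: "\<And>a. a \<in> D \<Longrightarrow> f a \<in> E"
    and iff: "\<And>a b. a \<in> D \<Longrightarrow> b \<in> D \<Longrightarrow> R a b \<longleftrightarrow> S (f a) (f b)"
    and hom: "\<And>a b. a \<in> D \<Longrightarrow> b \<in> D \<Longrightarrow> f (app a b) = app' (f a) (f b)"
    and surj: "\<And>b. b \<in> E \<Longrightarrow> \<exists>a\<in>D. S (f a) b"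
  shows "quot_monoid R D app e \<cong> quot_monoid S E app' e'"
proof -
  let ?c = "\<lambda>w. {v. R w v}" and ?k = "\<lambda>w. {v. S w v}"
  have ceq: "?c a = ?c b \<longleftrightarrow> R a b" if "a \<in> D" "b \<in> D" for a b
  proof
    assume "?c a = ?c b"
    then have "b \<in> ?c a" using reflR that by simp
    then show "R a b" by simp
  qed (use symR transR in blast)
  have keq: "?k a = ?k b" if "S a b" for a b
    using that symS transS by blast
  have kne: "S a b" if "?k a = ?k b" "b \<in> E" for a b
  proof -
    have "b \<in> ?k a" using that reflS by simp
    then show ?thesis by simp
  qed
  \<comment> \<open>A class may contain elements outside \<open>D\<close>, for instance words with
    foreign letters; representatives are therefore chosen in the intersection with
    \<open>D\<close>.\<close>
  have pick: "R a (SOME b. b \<in> ?c a \<inter> D) \<and> (SOME b. b \<in> ?c a \<inter> D) \<in> D" if "a \<in> D" for a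
    using someI[of "\<lambda>b. b \<in> ?c a \<inter> D" a] reflR that by simp
  have pick': "S a (SOME b. b \<in> ?k a \<inter> E)" if "a \<in> E" for a
    using someI[of "\<lambda>b. b \<in> ?k a \<inter> E" a] reflS that by simp
  let ?h = "\<lambda>A. ?k (f (SOME a. a \<in> A \<inter> D))"
  have h: "?h (?c a) = ?k (f a)" if "a \<in> D" for a
    using pick[OF that] iff that by (intro keq) (blast intro: symS)
  let ?G = "quot_monoid R D app e" and ?H = "quot_monoid S E app' e'"
  have carG: "carrier ?G = ?c ` D" and carH: "carrier ?H = ?k ` E" by (simp_all add: quot_monoid_def)
  have mG: "?c a \<otimes>\<^bsub>?G\<^esub> ?c b = ?c (app a b)" if "a \<in> D" "b \<in> D" for a b
  proof -
    let ?a = "SOME x. x \<in> ?c a \<inter> D" and ?b = "SOME x. x \<in> ?c b \<inter> D"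
    have ab: "R a ?a" "?a \<in> D" "R b ?b" "?b \<in> D" using pick that by auto
    then have "S (app' (f ?a) (f ?b)) (app' (f a) (f b))"
      using iff that by (intro congS) (auto intro: symS)
    then have "R (app ?a ?b) (app a b)" using iff hom closed that ab by simp
    then have "?c (app ?a ?b) = ?c (app a b)" using ceq closed that ab by simp
    then show ?thesis by (simp add: quot_monoid_def)
  qed
  have mH: "?k a \<otimes>\<^bsub>?H\<^esub> ?k b = ?k (app' a b)" if "a \<in> E" "b \<in> E" for a b
    using keq[OF congS[OF pick'[OF that(1)] pick'[OF that(2)]]] by (simp add: quot_monoid_def)
  have "?h \<in> hom ?G ?H"
  proof (rule homI)
    fix A assume "A \<in> carrier ?G"
    then obtain a where "a \<in> D" "A = ?c a" using carG by auto
    then show "?h A \<in> carrier ?H" using h f carH by auto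
  next
    fix A B assume "A \<in> carrier ?G" "B \<in> carrier ?G"
    then obtain a b where ab: "a \<in> D" "A = ?c a" "b \<in> D" "B = ?c b" using carG by auto
    have "?h (A \<otimes>\<^bsub>?G\<^esub> B) = ?k (app' (f a) (f b))"
      unfolding ab mG[OF ab(1,3)] by (subst h) (use ab closed hom in auto)
    also have "\<dots> = ?h A \<otimes>\<^bsub>?H\<^esub> ?h B" unfolding ab h[OF ab(1)] h[OF ab(3)] using mH f ab by simp
    finally show "?h (A \<otimes>\<^bsub>?G\<^esub> B) = ?h A \<otimes>\<^bsub>?H\<^esub> ?h B" .
  qed
  moreover have "bij_betw ?h (carrier ?G) (carrier ?H)"
  proof (rule bij_betw_imageI)
    show "inj_on ?h (carrier ?G)"
    proof (rule inj_onI)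
      fix A B assume "A \<in> carrier ?G" "B \<in> carrier ?G" and eq: "?h A = ?h B"
      then obtain a b where ab: "a \<in> D" "A = ?c a" "b \<in> D" "B = ?c b" using carG by auto
      have "S (f a) (f b)" using eq unfolding ab h[OF ab(1)] h[OF ab(3)] using kne f ab by blast
      then show "A = B" using ab iff ceq by simp
    qed
    show "?h ` carrier ?G = carrier ?H"
    proof
      show "?h ` carrier ?G \<subseteq> carrier ?H"
        using h f unfolding carG carH by auto
      show "carrier ?H \<subseteq> ?h ` carrier ?G"
      proof
        fix B assume "B \<in> carrier ?H"
        then obtain b where b: "b \<in> E" "B = ?k b" using carH by auto
        then obtain a where "a \<in> D" "S (f a) b" using surj by blast
        then have "?h (?c a) = B" using h keq b by simp
        then show "B \<in> ?h ` carrier ?G" using \<open>a \<in> D\<close> carG by blast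
      qed
    qed
  qed
  ultimately show ?thesis by (intro is_isoI) (simp add: iso_def)
qed

section \<open>Equality of words in a presented group\<close>

lemma pres_eq_context: "pres_eq R u v \<Longrightarrow> pres_eq R (w @ u @ w') (w @ v @ w')"
proof (induction rule: pres_eq.induct)
  case (pe_sym u v)
  then show ?case by (blast intro: pres_eq.pe_sym)
next
  case (pe_trans u v w)
  then show ?case by (blast intro: pres_eq.pe_trans)
next
  case (pe_cancel u x b v)
  show ?case using pres_eq.pe_cancel[of R "w @ u" x b "v @ w'"] by simp
next
  case (pe_rel r u v)
  show ?case using pres_eq.pe_rel[OF pe_rel, of "w @ u" "v @ w'"] by simp
qed (rule pe_refl)

lemma pres_eq_append: "pres_eq R u u' \<Longrightarrow> pres_eq R v v' \<Longrightarrow> pres_eq R (u @ v) (u' @ v')"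
  using pres_eq_context[of R u u' "[]" v] pres_eq_context[of R v v' u' "[]"]
  by (auto intro: pe_trans)

definition inv_word :: "(nat \<times> bool) list \<Rightarrow> (nat \<times> bool) list" where
  "inv_word u = rev (map (\<lambda>(x, b). (x, \<not> b)) u)"

lemma inv_word_inv_word: "inv_word (inv_word u) = u"
  by (simp add: inv_word_def rev_map case_prod_beta comp_def)

lemma inv_word_lists: "u \<in> lists (X \<times> UNIV) \<Longrightarrow> inv_word u \<in> lists (X \<times> UNIV)"
  by (auto simp: inv_word_def)

lemma pres_eq_right_inverse: "pres_eq R (u @ inv_word u) []"
proof (induction u rule: rev_induct)
  case Nil
  show ?case by (simp add: inv_word_def pe_refl)
next
  case (snoc l u)
  obtain x b where l: "l = (x, b)" by (cases l)
  have "pres_eq R (u @ [(x, b), (x, \<not> b)] @ inv_word u) (u @ inv_word u)" by (rule pe_cancel)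
  then show ?case using snoc by (auto simp: l inv_word_def intro: pe_trans)
qed

lemma pres_eq_left_inverse: "pres_eq R (inv_word u @ u) []"
  using pres_eq_right_inverse[of R "inv_word u"] by (simp add: inv_word_inv_word)

section \<open>The quiver and its ideals\<close>

declare One_nat_def [simp del]

type_synonym word = "(nat \<times> bool) list"

text \<open>Arrows are numbered by triples of a kind (0, 1, 2, 3 for \<open>a\<close>, \<open>b\<close>, \<open>c\<close>, \<open>d\<close>), the index
  of a group and a word. The empty word is the common unit of all groups, so the index is
  dropped there.\<close>

definition code :: "nat \<Rightarrow> nat \<Rightarrow> word \<Rightarrow> nat" where
  "code k i u = to_nat (k, if u = [] then 0 else i, u)"

definition kind :: "nat \<Rightarrow> nat" where
  "kind e = fst (from_nat e :: nat \<times> nat \<times> word)"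

definition group_of :: "nat \<Rightarrow> nat" where
  "group_of e = fst (snd (from_nat e :: nat \<times> nat \<times> word))"

definition word_of :: "nat \<Rightarrow> word" where
  "word_of e = snd (snd (from_nat e :: nat \<times> nat \<times> word))"

definition base :: "nat \<Rightarrow> nat" where
  "base e = code (kind e) 0 []"

text \<open>The value of an arrow in the \<open>i\<close>-th group: arrows of all other groups count
  as trivial. Both the grading of paths and the isomorphism with the fundamental group are read off
  from it.\<close>

definition label :: "nat \<Rightarrow> nat \<Rightarrow> word" where
  "label i e = (if group_of e = i then word_of e else [])"

text \<open>Base arrows carry the empty word, so the parameter vanishes on them, as the composition
  law for substitutions demands.\<close>

definition shift_off :: "nat \<Rightarrow> nat \<Rightarrow> 'k::field" where
  "shift_off i e = (if word_of e \<noteq> [] \<and> group_of e \<noteq> i then - 1 else 0)"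

lemma kind_code [simp]: "kind (code k i u) = k"
  by (simp add: kind_def code_def)

lemma group_of_code [simp]: "group_of (code k i u) = (if u = [] then 0 else i)"
  by (simp add: group_of_def code_def)

lemma word_of_code [simp]: "word_of (code k i u) = u"
  by (simp add: word_of_def code_def)

lemma code_eq_iff [simp]: "code k i u = code k' i' u' \<longleftrightarrow> k = k' \<and> u = u' \<and> (u = [] \<or> i = i')"
  by (auto simp: code_def)

lemma label_code [simp]: "label i (code k j u) = (if j = i then u else [])"
  by (simp add: label_def)

lemma base_code [simp]: "base (code k i u) = code k 0 []"
  by (simp add: base_def)

lemma shift_off_code [simp]: "shift_off i (code k j u) = (if u \<noteq> [] \<and> j \<noteq> i then - 1 else 0)"
  by (simp add: shift_off_def)

lemma shift_off_base [simp]: "shift_off i (base e) = 0"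
  by (simp add: base_def)

definition word_of_step :: "nat \<Rightarrow> nat \<times> bool \<Rightarrow> word" where
  "word_of_step i s = (if snd s then label i (fst s) else inv_word (label i (fst s)))"

definition word_of_walk :: "nat \<Rightarrow> (nat \<times> bool) list \<Rightarrow> word" where
  "word_of_walk i s = concat (map (word_of_step i) s)"

lemma inv_word_Nil [simp]: "inv_word [] = []"
  by (simp add: inv_word_def)

lemma word_of_walk_Nil [simp]: "word_of_walk i [] = []"
  and word_of_walk_Cons [simp]: "word_of_walk i (e # s) = word_of_step i e @ word_of_walk i s"
  and word_of_walk_append [simp]: "word_of_walk i (s @ t) = word_of_walk i s @ word_of_walk i t"
  by (simp_all add: word_of_walk_def)

text \<open>\<open>N\<close> is the maximal length of labels: bounded, so that there are finitely
  many arrows; at least the length of each relator, so that relators are labels; and positive, so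
  that single letters are labels.\<close>

locale group_family =
  fixes n N :: nat and X :: "nat \<Rightarrow> nat set" and R :: "nat \<Rightarrow> word set"
  assumes finite_X: "i < n \<Longrightarrow> finite (X i)"
    and relators: "i < n \<Longrightarrow> R i \<subseteq> lists (X i \<times> UNIV)"
    and length_relator: "i < n \<Longrightarrow> r \<in> R i \<Longrightarrow> length r \<le> N"
    and N_pos: "N \<ge> 1"
begin

definition words :: "nat \<Rightarrow> word set" where
  "words i = {u \<in> lists (X i \<times> UNIV). length u \<le> N}"

definition Q :: quiver where
  "Q = \<lparr>verts = {..4},
    arrs = {code k i u |k i u. k < 4 \<and> (u = [] \<or> k < 2 \<and> i < n \<and> u \<in> words i)},
    src = (\<lambda>e. if kind e = 0 then 0 else if kind e = 3 then 4 else 1),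
    tgt = (\<lambda>e. if kind e = 1 then 2 else if kind e = 2 then 3 else 1)\<rparr>"

lemma Nil_words [simp]: "[] \<in> words i"
  by (simp add: words_def)

lemma finite_words: "i < n \<Longrightarrow> finite (words i)"
  using finite_lists_length_le[of "X i \<times> (UNIV :: bool set)" N] finite_X
  by (simp add: words_def lists_eq_set conj_commute Collect_conj_eq)

lemma verts_Q [simp]: "verts Q = {..4}"
  and src_Q: "src Q e = (if kind e = 0 then 0 else if kind e = 3 then 4 else 1)"
  and tgt_Q: "tgt Q e = (if kind e = 1 then 2 else if kind e = 2 then 3 else 1)"
  by (simp_all add: Q_def)

lemma code_arrs [simp]: "code k i u \<in> arrs Q \<longleftrightarrow> k < 4 \<and> (u = [] \<or> k < 2 \<and> i < n \<and> u \<in> words i)"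
  by (auto simp: Q_def)

lemma arrs_QE:
  assumes "e \<in> arrs Q"
  obtains k i u where "e = code k i u" "k < 4" "u = [] \<or> k < 2 \<and> i < n \<and> u \<in> words i"
  using assms by (auto simp: Q_def)

lemma finite_quiver_Q: "finite_quiver Q"
proof -
  have "arrs Q \<subseteq> (\<lambda>(k, i, u). code k i u) ` ({..<4} \<times> insert 0 {..<n} \<times> insert [] (\<Union>i<n. words i))"
  proof
    fix e assume "e \<in> arrs Q"
    then obtain k i u where e: "e = code k i u" "k < 4" "u = [] \<or> k < 2 \<and> i < n \<and> u \<in> words i"
      by (rule arrs_QE)
    then have "e = code k (if u = [] then 0 else i) u" by simp
    with e show "e \<in> (\<lambda>(k, i, u). code k i u) ` ({..<4} \<times> insert 0 {..<n} \<times> insert [] (\<Union>i<n. words i))"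
      by (intro image_eqI[of _ _ "(k, if u = [] then 0 else i, u)"]) auto
  qed
  then have "finite (arrs Q)" by (rule finite_subset) (auto simp: finite_words)
  then show ?thesis by (auto simp: finite_quiver_def src_Q tgt_Q)
qed

sublocale arrow_shift Q base
proof
  show "finite_quiver Q" by (rule finite_quiver_Q)
qed (auto elim!: arrs_QE simp: src_Q tgt_Q)

text \<open>A level function with values 0, 1, 2 that every arrow raises by one. It bounds the
  length of paths by two and excludes oriented cycles.\<close>

definition height :: "nat \<Rightarrow> nat" where
  "height v = (if v = 0 \<or> v = 4 then 0 else if v = 1 then 1 else 2)"

lemma height_path: "walk_end Q x (fwd as) = Some y \<Longrightarrow> height y = height x + length as"
proof (induction as arbitrary: x)
  case (Cons a as)
  then have "a \<in> arrs Q" "x = src Q a" "walk_end Q (tgt Q a) (fwd as) = Some y"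
    by (auto simp: fwd_def split: if_splits)
  moreover from this(1) have "height (tgt Q a) = height (src Q a) + 1"
    by (elim arrs_QE) (auto simp: src_Q tgt_Q height_def)
  ultimately show ?case using Cons.IH by simp
qed (simp add: fwd_def split: if_splits)

lemma path_length_le_2: "is_path Q p \<Longrightarrow> length (snd p) \<le> 2"
  using height_path[of "fst p" "snd p"] by (fastforce simp: is_path_def height_def split: if_splits)

lemma no_oriented_cycles_Q: "no_oriented_cycles Q"
  using height_path by (fastforce simp: no_oriented_cycles_def is_path_def path_end_def)

lemma is_path_2 [simp]:
  "is_path Q (x, [a, b]) \<longleftrightarrow> a \<in> arrs Q \<and> b \<in> arrs Q \<and> src Q a = x \<and> tgt Q a = src Q b"
  using finite_quiver_Q by (auto simp: is_path_def fwd_def finite_quiver_def)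

lemma path_end_2 [simp]: "is_path Q (x, [a, b]) \<Longrightarrow> path_end Q (x, [a, b]) = tgt Q b"
  using finite_quiver_Q by (auto simp: path_end_def fwd_def is_path_def finite_quiver_def split: if_splits)

inductive_set gens :: "(path \<Rightarrow> 'k::field) set" where
  mult: "i < n \<Longrightarrow> u \<in> words i \<Longrightarrow> v \<in> words i \<Longrightarrow> u' \<in> words i \<Longrightarrow> v' \<in> words i \<Longrightarrow>
    pres_eq (R i) (u @ v) (u' @ v') \<Longrightarrow>
    pa_diff (basis_elt (0, [code 0 i u, code 1 i v])) (basis_elt (0, [code 0 i u', code 1 i v'])) \<in> gens"
| left: "i < n \<Longrightarrow> u \<in> words i \<Longrightarrow> u \<noteq> [] \<Longrightarrow> basis_elt (0, [code 0 i u, code 2 0 []]) \<in> gens"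
| right: "i < n \<Longrightarrow> u \<in> words i \<Longrightarrow> u \<noteq> [] \<Longrightarrow> basis_elt (4, [code 3 0 [], code 1 i u]) \<in> gens"

definition I0 :: "(path \<Rightarrow> 'k::field) set" where
  "I0 = lin_span gens"

definition ideal :: "nat \<Rightarrow> (path \<Rightarrow> 'k::field) set" where
  "ideal i = shift (shift_off i) ` I0"

section \<open>Admissibility of the ideals and isomorphism of the quotients\<close>

lemma gens_in_path_alg: "gens \<subseteq> path_alg Q"
proof
  fix f :: "path \<Rightarrow> 'k::field" assume "f \<in> gens"
  then show "f \<in> path_alg Q"
    by (cases rule: gens.cases) (auto intro!: pa_diff_in_path_alg basis_elt_in_path_alg simp: src_Q tgt_Q)
qed

lemma gens_parallel:
  assumes "f \<in> gens"
  shows "\<exists>x y. \<forall>p. f p \<noteq> 0 \<longrightarrow> length (snd p) = 2 \<and> fst p = x \<and> path_end Q p = y"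
  using assms
proof (cases rule: gens.cases)
  case mult
  then show ?thesis
    by (intro exI[of _ 0] exI[of _ 2])
      (auto simp: pa_diff_def basis_elt_def src_Q tgt_Q split: if_splits)
next
  case left
  then show ?thesis
    by (intro exI[of _ 0] exI[of _ 3]) (auto simp: basis_elt_def src_Q tgt_Q split: if_splits)
next
  case right
  then show ?thesis
    by (intro exI[of _ 4] exI[of _ 2]) (auto simp: basis_elt_def src_Q tgt_Q split: if_splits)
qed

lemma pa_ideal_I0: "pa_ideal Q I0"
  unfolding I0_def by (rule pa_ideal_lin_span[OF path_length_le_2 gens_in_path_alg gens_parallel])

lemma I0_in_path_alg: "I0 \<subseteq> path_alg Q"
  unfolding I0_def by (rule lin_span_in_path_alg[OF gens_in_path_alg])

lemma pa_ideal_ideal: "pa_ideal Q (ideal i)"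
  unfolding ideal_def by (rule pa_ideal_shift[OF pa_ideal_I0]) simp

lemma ideal_iff: "f \<in> path_alg Q \<Longrightarrow> f \<in> ideal i \<longleftrightarrow> shift (\<lambda>e. - shift_off i e) f \<in> I0"
  unfolding ideal_def by (rule shift_image_iff[OF I0_in_path_alg]) auto

lemma I0_length:
  assumes "f \<in> I0" "f p \<noteq> 0"
  shows "length (snd p) = 2"
  using assms unfolding I0_def
proof (induction rule: lin_span.induct)
  case (step f h c)
  show ?case
  proof (cases "f p = 0")
    case True
    then show ?thesis using step by (simp add: pa_add_def pa_smult_def)
  next
    case False
    then show ?thesis using gens_parallel[OF step(1)] by blast
  qed
qed simp

lemma admissible_ideal: "admissible Q (ideal i :: (path \<Rightarrow> 'k::field) set)"
proof (rule admissibleI[OF finite_quiver_Q pa_ideal_ideal _ path_length_le_2])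
  fix f :: "path \<Rightarrow> 'k" and p assume f: "f \<in> ideal i" "f p \<noteq> 0"
  obtain g where g: "g \<in> I0" "f = shift (shift_off i) g" using f by (auto simp: ideal_def)
  obtain x as where p: "p = (x, as)" by (cases p)
  obtain bs where "linked (shift_off i :: nat \<Rightarrow> 'k) as bs" "g (x, bs) \<noteq> 0"
    using f unfolding g p by (rule_tac shift_nonzeroE) auto
  then show "length (snd p) = 2" using I0_length[OF g(1)] linked_length p by fastforce
qed

lemma quotients_iso_ideal: "quotients_iso Q (ideal i) (ideal j)"
  unfolding ideal_def by (rule quotients_iso_shift[OF pa_ideal_I0]) simp_all

text \<open>Reading off this coefficient is a linear functional that vanishes on all generators, as
  the monomials are taken for nonempty words only. It will keep \<open>a_1 c\<close> out of the
  substituted ideals; \<open>I0_right_unit\<close> does the same for \<open>d b_1\<close>.\<close>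

lemma I0_left_unit: "f \<in> I0 \<Longrightarrow> f (0, [code 0 0 [], code 2 0 []]) = 0"
  unfolding I0_def
proof (induction rule: lin_span.induct)
  case (step f h c)
  from step(1) have "f (0, [code 0 0 [], code 2 0 []]) = 0"
    by (cases rule: gens.cases) (auto simp: pa_diff_def basis_elt_def)
  with step show ?case by (simp add: pa_add_def pa_smult_def)
qed simp

lemma I0_right_unit: "f \<in> I0 \<Longrightarrow> f (4, [code 3 0 [], code 1 0 []]) = 0"
  unfolding I0_def
proof (induction rule: lin_span.induct)
  case (step f h c)
  from step(1) have "f (4, [code 3 0 [], code 1 0 []]) = 0"
    by (cases rule: gens.cases) (auto simp: pa_diff_def basis_elt_def)
  with step show ?case by (simp add: pa_add_def pa_smult_def)
qed simp

definition mult_paths :: "path set" where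
  "mult_paths = {(0, [a, b]) |a b. a \<in> arrs Q \<and> b \<in> arrs Q \<and> kind a = 0 \<and> kind b = 1}"

lemma mem_mult_paths: "(x, [a, b]) \<in> mult_paths \<longleftrightarrow>
    x = 0 \<and> a \<in> arrs Q \<and> b \<in> arrs Q \<and> kind a = 0 \<and> kind b = 1"
  by (auto simp: mult_paths_def)

lemma finite_mult_paths: "finite mult_paths"
  by (rule finite_subset[of _ "(\<lambda>(a, b). (0, [a, b])) ` (arrs Q \<times> arrs Q)"]) (auto simp: mult_paths_def)

lemma sum_basis_elt: "(\<Sum>p\<in>mult_paths. basis_elt q p) = (if q \<in> mult_paths then 1 else (0::'k::field))"
  unfolding basis_elt_def using finite_mult_paths by simp

text \<open>The coefficients of each binomial cancel, and the monomial generators lie off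
  \<open>mult_paths\<close>. Consequently no single path \<open>a_u b_v\<close> belongs to
  \<open>I0\<close>.\<close>

lemma I0_sum: "f \<in> I0 \<Longrightarrow> (\<Sum>p\<in>mult_paths. f p) = 0"
  unfolding I0_def
proof (induction rule: lin_span.induct)
  case (step f h c)
  from step(1) have "(\<Sum>p\<in>mult_paths. f p) = 0"
    by (cases rule: gens.cases) (auto simp: pa_diff_def sum_subtractf sum_basis_elt mem_mult_paths)
  with step show ?case by (simp add: pa_add_def pa_smult_def sum.distrib flip: sum_distrib_left)
qed simp

text \<open>Labels of the \<open>i\<close>-th group are fixed by the \<open>i\<close>-th
  substitution, so membership in \<open>ideal i\<close> reduces to membership in \<open>I0\<close>,
  where the coefficient sum decides.\<close>

lemma mult_notin_ideal:
  assumes "i < n" "u \<in> words i" "v \<in> words i"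
  shows "(basis_elt (0, [code 0 i u, code 1 i v]) :: path \<Rightarrow> 'k::field) \<notin> ideal i"
proof
  let ?p = "(0, [code 0 i u, code 1 i v]) :: path"
  assume "(basis_elt ?p :: path \<Rightarrow> 'k) \<in> ideal i"
  moreover have "(basis_elt ?p :: path \<Rightarrow> 'k) \<in> path_alg Q"
    using assms by (intro basis_elt_in_path_alg) (simp add: src_Q tgt_Q)
  ultimately have "(basis_elt ?p :: path \<Rightarrow> 'k) \<in> I0"
    using assms by (simp add: ideal_iff shift_basis_elt2_fixed)
  then have "(\<Sum>p\<in>mult_paths. basis_elt ?p p :: 'k) = 0" by (rule I0_sum)
  moreover have "?p \<in> mult_paths" using assms by (simp add: mem_mult_paths)
  ultimately show False by (simp add: sum_basis_elt)
qed

lemma htpy_mult: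
  assumes "i < n" "u \<in> words i" "v \<in> words i" "u' \<in> words i" "v' \<in> words i" "pres_eq (R i) (u @ v) (u' @ v')"
  shows "htpy Q (ideal i :: (path \<Rightarrow> 'k::field) set) (0, [(code 0 i u, True), (code 1 i v, True)])
    (0, [(code 0 i u', True), (code 1 i v', True)])"
proof -
  let ?p = "(0, [code 0 i u, code 1 i v]) :: path" and ?q = "(0, [code 0 i u', code 1 i v']) :: path"
  let ?r = "pa_diff (basis_elt ?p) (basis_elt ?q) :: path \<Rightarrow> 'k"
  have "?r \<in> gens" using assms by (rule gens.mult)
  then have "shift (shift_off i) ?r \<in> ideal i" unfolding ideal_def I0_def by (intro imageI lin_span_superset)
  moreover have "shift (shift_off i) ?r = ?r"
    using assms by (simp add: shift_diff shift_basis_elt2_fixed)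
  ultimately have r: "?r \<in> ideal i" by simp
  have "htpy Q (ideal i :: (path \<Rightarrow> 'k) set) (fst ?p, fwd (snd ?p)) (fst ?q, fwd (snd ?q))"
    by (rule htpy_binomial[OF pa_ideal_ideal _ _ _ r])
      (use assms mult_notin_ideal in \<open>simp_all add: src_Q tgt_Q\<close>)
  then show ?thesis by (simp add: fwd_def)
qed

text \<open>The common core of the relations that kill foreign labels. The substitution turns the
  monomial \<open>p\<close> into \<open>p - q\<close>. Pulled back, \<open>p\<close> and
  \<open>q\<close> become \<open>p + q\<close> and \<open>q\<close>, both with coefficient 1 at
  \<open>q\<close>, while all elements of \<open>I0\<close> have coefficient 0 there; so neither
  path lies in the ideal and the binomial is minimal.\<close>

lemma htpy_switch:
  assumes path: "is_path Q p" "is_path Q q" and par: "fst p = fst q" "path_end Q p = path_end Q q"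
    and neq: "p \<noteq> q" and p: "basis_elt p \<in> (gens :: (path \<Rightarrow> 'k::field) set)"
    and q: "\<And>f. f \<in> (I0 :: (path \<Rightarrow> 'k) set) \<Longrightarrow> f q = 0"
    and sh: "shift (shift_off i) (basis_elt p) = pa_diff (basis_elt p) (basis_elt q :: path \<Rightarrow> 'k)"
      "shift (\<lambda>e. - shift_off i e) (basis_elt p) = pa_add (basis_elt p) (basis_elt q :: path \<Rightarrow> 'k)"
      "shift (\<lambda>e. - shift_off i e) (basis_elt q) = (basis_elt q :: path \<Rightarrow> 'k)"
  shows "htpy Q (ideal i :: (path \<Rightarrow> 'k) set) (fst p, fwd (snd p)) (fst q, fwd (snd q))"
proof (rule htpy_binomial[OF pa_ideal_ideal par path(1)])
  have "shift (shift_off i) (basis_elt p) \<in> (ideal i :: (path \<Rightarrow> 'k) set)"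
    unfolding ideal_def I0_def using p by (intro imageI lin_span_superset)
  then show "pa_diff (basis_elt p) (basis_elt q) \<in> (ideal i :: (path \<Rightarrow> 'k) set)" by (simp add: sh)
  show "basis_elt p \<notin> (ideal i :: (path \<Rightarrow> 'k) set)"
    unfolding ideal_iff[OF basis_elt_in_path_alg[OF path(1)]] sh(2)
    using q[of "pa_add (basis_elt p) (basis_elt q)"] neq by (auto simp: pa_add_def basis_elt_def)
  show "basis_elt q \<notin> (ideal i :: (path \<Rightarrow> 'k) set)"
    unfolding ideal_iff[OF basis_elt_in_path_alg[OF path(2)]] sh(3)
    using q[of "basis_elt q"] by (auto simp: basis_elt_def)
qed

lemma htpy_left:
  assumes "j < n" "j \<noteq> i" "u \<in> words j" "u \<noteq> []"
  shows "htpy Q (ideal i :: (path \<Rightarrow> 'k::field) set) (0, [(code 0 j u, True), (code 2 0 [], True)])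
    (0, [(code 0 0 [], True), (code 2 0 [], True)])"
proof -
  let ?p = "(0, [code 0 j u, code 2 0 []]) :: path" and ?q = "(0, [code 0 0 [], code 2 0 []]) :: path"
  have "htpy Q (ideal i :: (path \<Rightarrow> 'k) set) (fst ?p, fwd (snd ?p)) (fst ?q, fwd (snd ?q))"
    by (rule htpy_switch[OF _ _ _ _ _ _ I0_left_unit])
      (use assms in \<open>simp_all add: src_Q tgt_Q gens.left shift_basis_elt2_left shift_basis_elt2_fixed
        pa_diff_conv, simp_all add: pa_smult_def pa_add_def\<close>)
  then show ?thesis by (simp add: fwd_def)
qed

lemma htpy_right:
  assumes "j < n" "j \<noteq> i" "u \<in> words j" "u \<noteq> []"
  shows "htpy Q (ideal i :: (path \<Rightarrow> 'k::field) set) (4, [(code 3 0 [], True), (code 1 j u, True)])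
    (4, [(code 3 0 [], True), (code 1 0 [], True)])"
proof -
  let ?p = "(4, [code 3 0 [], code 1 j u]) :: path" and ?q = "(4, [code 3 0 [], code 1 0 []]) :: path"
  have "htpy Q (ideal i :: (path \<Rightarrow> 'k) set) (fst ?p, fwd (snd ?p)) (fst ?q, fwd (snd ?q))"
    by (rule htpy_switch[OF _ _ _ _ _ _ I0_right_unit])
      (use assms in \<open>simp_all add: src_Q tgt_Q gens.right shift_basis_elt2_right shift_basis_elt2_fixed
        pa_diff_conv, simp_all add: pa_smult_def pa_add_def\<close>)
  then show ?thesis by (simp add: fwd_def)
qed

section \<open>Grading of paths by the class of their labels in the \<open>i\<close>-th
  group\<close>

definition degree_class :: "nat \<Rightarrow> path \<Rightarrow> word set" where
  "degree_class i p = {v. pres_eq (R i) (word_of_walk i (fwd (snd p))) v}"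

lemma degree_class_eq_iff:
  "degree_class i p = degree_class i q \<longleftrightarrow>
    pres_eq (R i) (word_of_walk i (fwd (snd p))) (word_of_walk i (fwd (snd q)))"
  unfolding degree_class_def by (auto intro: pe_refl pe_sym pe_trans)

text \<open>A binomial of the \<open>i\<close>-th group is homogeneous by the equation that defines
  it; in a binomial of another group all labels count as empty; a monomial has a single
  term.\<close>

lemma gens_homogeneous:
  assumes "f \<in> gens"
  shows "\<exists>g. \<forall>p. f p \<noteq> 0 \<longrightarrow> degree_class i p = g"
  using assms
proof (cases rule: gens.cases)
  case mult: (mult j u v u' v')
  have "degree_class i (0, [code 0 j u', code 1 j v']) = degree_class i (0, [code 0 j u, code 1 j v])"
    unfolding degree_class_eq_iff
    using mult by (auto simp: fwd_def word_of_step_def intro: pe_refl pe_sym)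
  then show ?thesis
    by (intro exI[of _ "degree_class i (0, [code 0 j u, code 1 j v])"])
      (auto simp: mult(1) pa_diff_def basis_elt_def split: if_splits)
qed (auto simp: basis_elt_def)

lemma I0_graded: "f \<in> I0 \<Longrightarrow> (\<lambda>p. if degree_class i p = g then f p else 0) \<in> I0"
  unfolding I0_def
proof (induction rule: lin_span.induct)
  case zero
  then show ?case by (simp add: lin_span.zero)
next
  case (step f h c)
  let ?c = "\<lambda>f p. if degree_class i p = g then f p else 0"
  obtain g' where g': "\<forall>p. f p \<noteq> 0 \<longrightarrow> degree_class i p = g'" using gens_homogeneous[OF step(1)] by blast
  \<comment> \<open>A homogeneous generator either is its own component or has component
    zero.\<close>
  have "?c f = pa_smult (if g' = g then 1 else 0) f"
  proof
    fix p
    show "?c f p = pa_smult (if g' = g then 1 else 0) f p"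
      using g'[rule_format, of p] by (cases "f p = 0") (simp_all add: pa_smult_def)
  qed
  then have "?c f \<in> lin_span gens"
    using step(1) by (simp add: lin_span_smult lin_span_superset)
  moreover have "?c (pa_add (pa_smult c f) h) = pa_add (pa_smult c (?c f)) (?c h)"
    by (auto simp: pa_add_def pa_smult_def)
  ultimately show ?case using step.IH by (simp add: lin_span_add lin_span_smult)
qed

lemma ideal_graded:
  assumes "f \<in> ideal i"
  shows "(\<lambda>p. if degree_class i p = g then f p else 0) \<in> (ideal i :: (path \<Rightarrow> 'k::field) set)"
proof -
  obtain h where h: "h \<in> I0" "f = shift (shift_off i) h" using assms by (auto simp: ideal_def)
  \<comment> \<open>The substitution replaces an arrow by its base arrow only if its label is
    foreign, and then both count as the empty word for the \<open>i\<close>-th group.\<close>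
  have "degree_class i (x, as) = degree_class i (x, bs)" if "linked (shift_off i :: nat \<Rightarrow> 'k) as bs" for x as bs
  proof -
    have "word_of_walk i (fwd as) = word_of_walk i (fwd bs)"
      using that unfolding linked_def
      by (induction as bs rule: list_all2_induct)
        (auto simp: fwd_def word_of_step_def label_def shift_off_def base_def dest!: mat_nonzero split: if_splits)
    then show ?thesis by (simp add: degree_class_def)
  qed
  then have "(\<lambda>p. if degree_class i p = g then f p else 0) =
      shift (shift_off i) (\<lambda>p. if degree_class i p = g then h p else 0)"
    unfolding h(2) by (rule shift_component[symmetric])
  then show ?thesis using I0_graded[OF h(1)] by (simp add: ideal_def)
qed

text \<open>Homotopy creates no identifications beyond those of the \<open>i\<close>-th group: the
  formal inverses cancel in the word, and the paths of a minimal relation have equal degree because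
  the ideal is graded.\<close>

lemma htpy_word_of_walk:
  "htpy Q (ideal i :: (path \<Rightarrow> 'k::field) set) s t \<Longrightarrow>
    pres_eq (R i) (word_of_walk i (snd s)) (word_of_walk i (snd t))"
proof (induction rule: htpy.induct)
  case (h_rel \<rho> p q)
  have "degree_class i p = degree_class i q"
    by (rule minimal_relation_homogeneous[OF ideal_graded h_rel])
  then show ?case by (simp add: degree_class_eq_iff)
next
  case (h_ctx x u v z w w')
  then show ?case using pres_eq_context by simp
qed (auto simp: word_of_step_def pres_eq_right_inverse pres_eq_left_inverse
    intro: pe_refl pe_sym pe_trans)

end

section \<open>The fundamental groups\<close>

lemma code_Nil: "code k j [] = code k 0 []"
  by simp

context group_family
begin

section \<open>A spanning tree of base arrows, and connectedness\<close>

abbreviation "a0 \<equiv> (code 0 0 [], True)"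
abbreviation "a0' \<equiv> (code 0 0 [], False)"
abbreviation "b0 \<equiv> (code 1 0 [], True)"
abbreviation "b0' \<equiv> (code 1 0 [], False)"
abbreviation "c0 \<equiv> (code 2 0 [], True)"
abbreviation "c0' \<equiv> (code 2 0 [], False)"
abbreviation "d0 \<equiv> (code 3 0 [], True)"
abbreviation "d0' \<equiv> (code 3 0 [], False)"

text \<open>Walks from vertex 0 in the spanning tree. The last branch serves vertex 4, which is
  reached by traversing \<open>d\<close> backwards. All labels involved are empty, so moving along
  the tree leaves words unchanged.\<close>

definition tree :: "nat \<Rightarrow> (nat \<times> bool) list" where
  "tree v = (if v = 0 then [] else if v = 1 then [a0] else if v = 2 then [a0, b0]
    else if v = 3 then [a0, c0] else [a0, d0'])"

definition tree_inv :: "nat \<Rightarrow> (nat \<times> bool) list" where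
  "tree_inv v = (if v = 0 then [] else if v = 1 then [a0'] else if v = 2 then [b0', a0']
    else if v = 3 then [c0', a0'] else [d0, a0'])"

lemma walk_end_tree: "v \<in> verts Q \<Longrightarrow> walk_end Q 0 (tree v) = Some v"
  by (auto simp: tree_def src_Q tgt_Q)

lemma walk_end_tree_inv: "v \<in> verts Q \<Longrightarrow> walk_end Q v (tree_inv v) = Some 0"
  by (auto simp: tree_inv_def src_Q tgt_Q)

lemma word_of_walk_tree [simp]: "word_of_walk i (tree v) = []" "word_of_walk i (tree_inv v) = []"
  by (simp_all add: tree_def tree_inv_def word_of_step_def)

lemma connected_quiver_Q: "connected_quiver Q"
  unfolding connected_quiver_def
proof (intro conjI ballI)
  fix x y assume "x \<in> verts Q" "y \<in> verts Q"
  then show "\<exists>s. walk_end Q x s = Some y"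
    using walk_end_tree_inv[of x] walk_end_tree[of y]
    by (intro exI[of _ "tree_inv x @ tree y"]) (simp add: walk_end_append)
qed simp

end

section \<open>Homotopies modulo one of the ideals\<close>

locale group_family_at = group_family n N X R for n N X R +
  fixes i :: nat and J :: "(path \<Rightarrow> 'k::field) set"
  assumes i: "i < n" and J: "J = ideal i"
begin

sublocale bound_quiver Q J
  by standard (use finite_quiver_Q pa_ideal_ideal[of i] in \<open>auto simp: J pa_ideal_def\<close>)

lemma code_i_Nil [simp]: "code k i [] = code k 0 []"
  by simp

abbreviation "a u \<equiv> (code 0 i u, True)"
abbreviation "b u \<equiv> (code 1 i u, True)"

text \<open>A letter and its formal inverse have separate arrows; that their loops are inverse to
  each other is a consequence of the relations. Letters outside \<open>X i\<close> are sent to the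
  empty walk, because \<open>pres_eq\<close> may insert cancelling pairs of arbitrary
  letters.\<close>

definition loop :: "word \<Rightarrow> (nat \<times> bool) list" where
  "loop u = concat (map (\<lambda>l. if fst l \<in> X i then [a [l], a0'] else []) u)"

lemma loop_Nil [simp]: "loop [] = []"
  and loop_append [simp]: "loop (u @ v) = loop u @ loop v"
  by (simp_all add: loop_def)

lemma letter_words: "fst l \<in> X i \<Longrightarrow> [l] \<in> words i"
  using N_pos by (cases l) (auto simp: words_def)

lemma walk_end_loop [simp]: "walk_end Q 0 (loop u) = Some 0"
  by (induction u) (auto simp: loop_def src_Q tgt_Q i letter_words walk_end_append)

lemma homotopic_loop: "homotopic 0 (loop u) (loop u)"
  by (rule homotopic_refl) simp

lemma homotopic_mult:
  "u \<in> words i \<Longrightarrow> v \<in> words i \<Longrightarrow> u' \<in> words i \<Longrightarrow> v' \<in> words i \<Longrightarrow>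
    pres_eq (R i) (u @ v) (u' @ v') \<Longrightarrow> homotopic 0 [a u, b v] [a u', b v']"
  unfolding J using i by (rule htpy_mult)

text \<open>The relation identifies the two arrows followed by \<open>c\<close>, and
  \<open>c\<close> can be cancelled. In \<open>homotopic_b_off\<close> the arrow \<open>d\<close> is
  cancelled on the other side.\<close>

lemma homotopic_a_off:
  assumes "u = [] \<or> j < n \<and> j \<noteq> i \<and> u \<in> words j"
  shows "homotopic 0 [(code 0 j u, True)] [a0]"
proof (cases "u = []")
  case True
  show ?thesis unfolding True code_Nil[of 0 j] by (rule homotopic_refl) (simp add: src_Q tgt_Q)
next
  case False
  have "homotopic 0 ([(code 0 j u, True)] @ [c0]) ([a0] @ [c0])"
    using htpy_left[of j i u] assms False by (simp add: J)
  then show ?thesis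
    by (rule homotopic_cancel_right[where y = 1]) (use assms False in \<open>simp_all add: src_Q tgt_Q\<close>)
qed

lemma homotopic_b_off:
  assumes "u = [] \<or> j < n \<and> j \<noteq> i \<and> u \<in> words j"
  shows "homotopic 1 [(code 1 j u, True)] [b0]"
proof (cases "u = []")
  case True
  show ?thesis unfolding True code_Nil[of 1 j] by (rule homotopic_refl) (simp add: src_Q tgt_Q)
next
  case False
  have "homotopic 4 ([d0] @ [(code 1 j u, True)]) ([d0] @ [b0])"
    using htpy_right[of j i u] assms False by (simp add: J)
  then show ?thesis
    by (rule homotopic_cancel_left) (simp add: src_Q tgt_Q)
qed

text \<open>The relation for \<open>1 u = u 1\<close> moves the label from the arrow
  \<open>b\<close> to the arrow \<open>a\<close>.\<close>

lemma homotopic_b: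
  assumes "u \<in> words i" "homotopic 0 [a u] (loop u @ [a0])"
  shows "homotopic 0 [a0, b u] (loop u @ [a0, b0])"
proof -
  have "homotopic 0 [a0, b u] ([a u] @ [b0])"
    using homotopic_mult[of "[]" u u "[]"] assms(1) by (simp add: pe_refl)
  moreover have "homotopic 0 ([a u] @ [b0]) ((loop u @ [a0]) @ [b0])"
    by (rule homotopic_append_right[OF assms(2), where y = 1]) (use assms i in \<open>simp_all add: src_Q tgt_Q\<close>)
  ultimately show ?thesis by (auto intro: h_trans)
qed

text \<open>Splits a label into its letters. The product relation gives
  \<open>a_lv b_1 ~ a_l b_v\<close>; inserting \<open>a_1^-1 a_1\<close> in the middle separates the
  loop of \<open>l\<close> from \<open>a_1 b_v\<close>, to which the induction hypothesis applies
  through \<open>homotopic_b\<close>. Finally \<open>b_1\<close> is cancelled.\<close>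

lemma homotopic_a: "u \<in> words i \<Longrightarrow> homotopic 0 [a u] (loop u @ [a0])"
proof (induction u)
  case Nil
  then show ?case by (auto intro: homotopic_refl simp: src_Q tgt_Q)
next
  case (Cons l v)
  then have l: "fst l \<in> X i" "[l] \<in> words i" and v: "v \<in> words i"
    by (auto simp: words_def intro: letter_words)
  have "homotopic 0 [a (l # v), b0] [a [l], b v]"
    using homotopic_mult[of "l # v" "[]" "[l]" v] Cons.prems l v by (simp add: pe_refl)
  moreover have "homotopic 0 [a [l], b v] ([a [l]] @ [a0', a0] @ [b v])"
  proof -
    have "homotopic 1 ([a0', a0] @ [b v]) ([] @ [b v])"
      using homotopic_step_inverse(1)[of 1 "code 0 0 []" False 0] i v
      by (intro homotopic_append_right[where y = 1]) (simp_all add: src_Q tgt_Q)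
    then have "homotopic 0 ([a [l]] @ ([a0', a0] @ [b v])) ([a [l]] @ ([] @ [b v]))"
      by (rule homotopic_append_left) (use i l in \<open>simp add: src_Q tgt_Q\<close>)
    then show ?thesis by (simp add: h_sym)
  qed
  moreover have "homotopic 0 (loop [l] @ [a0, b v]) (loop [l] @ loop v @ [a0, b0])"
    by (rule homotopic_append_left[OF homotopic_b[OF v Cons.IH[OF v]]]) simp
  moreover have "loop [l] = [a [l], a0']" using l by (simp add: loop_def)
  moreover have "loop (l # v) = loop [l] @ loop v" by (simp add: loop_def)
  ultimately have "homotopic 0 ([a (l # v)] @ [b0]) ((loop (l # v) @ [a0]) @ [b0])"
    by simp (meson h_trans)
  then show ?case
    by (rule homotopic_cancel_right[where y = 1])
      (use Cons.prems i in \<open>simp_all add: src_Q tgt_Q walk_end_append\<close>)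
qed

lemma homotopic_ab:
  assumes "u \<in> words i" "v \<in> words i"
  shows "homotopic 0 [a u, b v] (loop u @ loop v @ [a0, b0])"
proof -
  have "homotopic 0 ([a u] @ [b v]) ((loop u @ [a0]) @ [b v])"
    by (rule homotopic_append_right[OF homotopic_a, where y = 1]) (use assms i in \<open>simp_all add: src_Q tgt_Q\<close>)
  moreover have "homotopic 0 (loop u @ [a0, b v]) (loop u @ loop v @ [a0, b0])"
    by (rule homotopic_append_left[OF homotopic_b]) (use assms homotopic_a in auto)
  ultimately show ?thesis by (auto intro: h_trans)
qed

text \<open>The relation with \<open>a_1 b_1\<close> yields this. It is stated for two factors so as
  to cover both a letter followed by its inverse and a relator followed by the empty word.\<close>

lemma homotopic_loop_null:
  assumes "u \<in> words i" "v \<in> words i" "pres_eq (R i) (u @ v) []"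
  shows "homotopic 0 (loop (u @ v)) []"
proof -
  have "homotopic 0 [a u, b v] [a0, b0]"
    using homotopic_mult[of u v "[]" "[]"] assms by simp
  then have "homotopic 0 (loop (u @ v) @ [a0, b0]) ([] @ [a0, b0])"
    using homotopic_ab[OF assms(1,2)] by (auto intro: h_sym h_trans)
  then show ?thesis by (rule homotopic_cancel_right) (simp_all add: walk_end_append)
qed

lemma homotopic_loop_pres_eq: "pres_eq (R i) u v \<Longrightarrow> homotopic 0 (loop u) (loop v)"
proof (induction rule: pres_eq.induct)
  case (pe_refl u)
  show ?case by (rule homotopic_loop)
next
  case (pe_sym u v)
  then show ?case by (rule_tac h_sym)
next
  case (pe_trans u v w)
  then show ?case by (rule_tac h_trans)
next
  case (pe_cancel u x b v)
  have "homotopic 0 (loop [(x, b), (x, \<not> b)]) []"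
  proof (cases "x \<in> X i")
    case True
    then show ?thesis
      using homotopic_loop_null[of "[(x, b)]" "[(x, \<not> b)]"] letter_words pres_eq.pe_cancel[of "R i" "[]" x b "[]"]
      by simp
  next
    case False
    then have "loop [(x, b), (x, \<not> b)] = []" by (simp add: loop_def)
    then show ?thesis by (auto intro: homotopic_refl)
  qed
  then have "homotopic 0 (loop u @ loop [(x, b), (x, \<not> b)] @ loop v) (loop u @ [] @ loop v)"
    by (intro homotopic_append_left homotopic_append_right[where y = 0]) simp_all
  then show ?case by (simp only: loop_append append_Nil)
next
  case (pe_rel r u v)
  have "r \<in> words i" using pe_rel relators[OF i] length_relator[OF i] by (auto simp: words_def)
  then have "homotopic 0 (loop r) []"
    using homotopic_loop_null[of r "[]"] pres_eq.pe_rel[OF pe_rel, of "[]" "[]"] by simp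
  then have "homotopic 0 (loop u @ loop r @ loop v) (loop u @ [] @ loop v)"
    by (intro homotopic_append_left homotopic_append_right[where y = 0]) simp_all
  then show ?case by (simp only: loop_append append_Nil)
qed

text \<open>Closing an arrow up through the tree leaves only the loop of its label. Arrows with
  foreign labels become homotopic to base arrows, whose closure is trivial.\<close>

lemma homotopic_tree_arrow:
  assumes "e \<in> arrs Q"
  shows "homotopic 0 (tree (src Q e) @ [(e, True)]) (loop (label i e) @ tree (tgt Q e))"
proof -
  obtain k j u where e: "e = code k j u" "k < 4" "u = [] \<or> k < 2 \<and> j < n \<and> u \<in> words j"
    using assms by (rule arrs_QE)
  consider "k = 0" | "k = 1" | "k = 2" "u = []" | "k = 3" "u = []" using e by linarith
  then show ?thesis
  proof cases
    case 1
    show ?thesis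
    proof (cases "j = i")
      case True
      then show ?thesis using homotopic_a[of u] e 1 by (auto simp: tree_def src_Q tgt_Q)
    next
      case False
      have "homotopic 0 [(code 0 j u, True)] [a0]"
        using homotopic_a_off[of u j] e False by auto
      then show ?thesis using False e 1 by (simp add: tree_def src_Q tgt_Q)
    qed
  next
    case 2
    show ?thesis
    proof (cases "j = i")
      case True
      then show ?thesis using homotopic_ab[of "[]" u] e 2 by (auto simp: tree_def src_Q tgt_Q)
    next
      case False
      have "homotopic 1 [(code 1 j u, True)] [b0]"
        using homotopic_b_off[of u j] e False by auto
      then have "homotopic 0 ([a0] @ [(code 1 j u, True)]) ([a0] @ [b0])"
        by (rule homotopic_append_left) (simp add: src_Q tgt_Q)
      then show ?thesis using False e 2 by (simp add: tree_def src_Q tgt_Q)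
    qed
  next
    case 3
    then have "e = code 2 0 []" using e by simp
    then show ?thesis by (auto intro!: homotopic_refl simp: tree_def src_Q tgt_Q)
  next
    case 4
    then have "e = code 3 0 []" using e by simp
    \<comment> \<open>The tree already reaches vertex 4 through the inverse of \<open>d\<close>, so
      appending \<open>d\<close> undoes that step.\<close>
    moreover have "homotopic 0 ([a0] @ [d0', d0]) ([a0] @ [])"
      using homotopic_step_inverse(1)[of 1 "code 3 0 []" False 4]
      by (intro homotopic_append_left[where y = 1]) (simp_all add: src_Q tgt_Q)
    ultimately show ?thesis by (simp add: tree_def src_Q tgt_Q)
  qed
qed

text \<open>The loop of an inverse word is not literally the reversed walk, so the forward case is
  multiplied by it on the left and the two loops are cancelled as words of the group.\<close>

lemma homotopic_tree_inverse_arrow: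
  assumes e: "e \<in> arrs Q"
  shows "homotopic 0 (tree (tgt Q e) @ [(e, False)]) (loop (inv_word (label i e)) @ tree (src Q e))"
proof -
  let ?w = "label i e"
  have v: "src Q e \<in> verts Q" "tgt Q e \<in> verts Q" using e finite_quiver_Q by (auto simp: finite_quiver_def)
  have st: "walk_end Q (src Q e) [(e, True)] = Some (tgt Q e)" "walk_end Q (tgt Q e) [(e, False)] = Some (src Q e)"
    using e v by auto
  note ends = walk_end_tree[OF v(1)] walk_end_tree[OF v(2)]
  have "homotopic 0 (tree (src Q e) @ [(e, True), (e, False)]) (tree (src Q e) @ [])"
    using homotopic_step_inverse(1)[OF st(1)] ends by (intro homotopic_append_left) auto
  moreover have "homotopic 0 ((tree (src Q e) @ [(e, True)]) @ [(e, False)]) ((loop ?w @ tree (tgt Q e)) @ [(e, False)])"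
    by (rule homotopic_append_right[OF homotopic_tree_arrow[OF e], where y = "tgt Q e"])
      (use ends st in \<open>simp_all add: walk_end_append\<close>)
  ultimately have "homotopic 0 (tree (src Q e)) (loop ?w @ tree (tgt Q e) @ [(e, False)])"
    by simp (meson h_sym h_trans)
  then have "homotopic 0 (loop (inv_word ?w) @ tree (src Q e))
      (loop (inv_word ?w) @ loop ?w @ tree (tgt Q e) @ [(e, False)])"
    by (rule homotopic_append_left) simp
  moreover have "homotopic 0 (loop (inv_word ?w @ ?w) @ tree (tgt Q e) @ [(e, False)])
      (loop [] @ tree (tgt Q e) @ [(e, False)])"
    by (rule homotopic_append_right[OF homotopic_loop_pres_eq[OF pres_eq_left_inverse], where y = 0])
      (use ends st in \<open>simp_all add: walk_end_append\<close>)
  ultimately show ?thesis by simp (meson h_sym h_trans)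
qed

text \<open>A normal form: up to homotopy, a walk is determined by its end vertices and the word
  read along it.\<close>

lemma homotopic_tree_walk:
  "walk_end Q x s = Some y \<Longrightarrow> homotopic 0 (tree x @ s) (loop (word_of_walk i s) @ tree y)"
proof (induction s arbitrary: x)
  case Nil
  then have "x = y" "x \<in> verts Q" by (simp_all split: if_splits)
  then show ?case using walk_end_tree by (auto intro: homotopic_refl)
next
  case (Cons st s)
  obtain e d where st: "st = (e, d)" by (cases st)
  let ?z = "if d then tgt Q e else src Q e"
  have e: "e \<in> arrs Q" "x = (if d then src Q e else tgt Q e)" "walk_end Q ?z s = Some y" and x: "x \<in> verts Q"
    using Cons.prems by (auto simp: st split: if_splits)
  have z: "?z \<in> verts Q" using e(3) by (rule walk_end_Some_start)
  have "homotopic 0 (tree x @ [st]) (loop (word_of_step i st) @ tree ?z)"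
    using homotopic_tree_arrow[OF e(1)] homotopic_tree_inverse_arrow[OF e(1)] e(2)
    by (cases d) (simp_all add: st word_of_step_def)
  then have "homotopic 0 ((tree x @ [st]) @ s) ((loop (word_of_step i st) @ tree ?z) @ s)"
    by (rule homotopic_append_right)
      (use e x z walk_end_tree[OF x] in \<open>auto simp: st walk_end_append split: if_splits\<close>)
  moreover have "homotopic 0 (loop (word_of_step i st) @ (tree ?z @ s))
      (loop (word_of_step i st) @ (loop (word_of_walk i s) @ tree y))"
    by (rule homotopic_append_left[OF Cons.IH[OF e(3)]]) simp
  ultimately show ?case by simp (meson h_trans)
qed

lemma word_of_walk_lists: "walk_end Q x s \<noteq> None \<Longrightarrow> word_of_walk i s \<in> lists (X i \<times> UNIV)"
proof (induction s arbitrary: x)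
  case (Cons st s)
  obtain e d where st: "st = (e, d)" by (cases st)
  have e: "e \<in> arrs Q" "walk_end Q (if d then tgt Q e else src Q e) s \<noteq> None"
    using Cons.prems by (auto simp: st split: if_splits)
  from e(1) have "label i e \<in> lists (X i \<times> UNIV)"
    by (rule arrs_QE) (auto simp: words_def)
  then have "word_of_step i st \<in> lists (X i \<times> UNIV)"
    by (auto simp: st word_of_step_def intro!: inv_word_lists)
  then show ?case using Cons.IH[OF e(2)] by simp
qed simp

lemma word_of_walk_loop: "u \<in> lists (X i \<times> UNIV) \<Longrightarrow> word_of_walk i (loop u) = u"
  by (induction u) (auto simp: loop_def word_of_step_def)

text \<open>Reading words is multiplicative. It is well defined by \<open>htpy_word_of_walk\<close>
  and injective by the normal form of walks; a word is reached by its loop at 0, transported to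
  \<open>v0\<close> along the tree, which adds no letters.\<close>

lemma pi1_iso:
  assumes v0: "v0 \<in> verts Q"
  shows "pi1 Q J v0 \<cong> presented_group (X i) (R i)"
  unfolding pi1_def presented_group_def
proof (rule quot_monoid_iso[where f = "\<lambda>(x, s). word_of_walk i s"])
  let ?D = "{(v0, s) |s. walk_end Q v0 s = Some v0}"
  show "htpy Q J p p" if "p \<in> ?D" for p
    using that by (auto intro: homotopic_refl)
  show "(case p of (x, s) \<Rightarrow> \<lambda>(y, t). (x, s @ t)) q \<in> ?D" if "p \<in> ?D" "q \<in> ?D" for p q
    using that by (auto simp: walk_end_append)
  show "(case p of (x, s) \<Rightarrow> word_of_walk i s) \<in> lists (X i \<times> UNIV)" if "p \<in> ?D" for p
    using that word_of_walk_lists[of v0] by auto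
  show "htpy Q J p q \<longleftrightarrow>
      pres_eq (R i) (case p of (x, s) \<Rightarrow> word_of_walk i s) (case q of (x, s) \<Rightarrow> word_of_walk i s)"
    if pq: "p \<in> ?D" "q \<in> ?D" for p q
  proof -
    obtain s t where st: "p = (v0, s)" "q = (v0, t)" "walk_end Q v0 s = Some v0" "walk_end Q v0 t = Some v0"
      using pq by auto
    have "homotopic v0 s t" if eq: "pres_eq (R i) (word_of_walk i s) (word_of_walk i t)"
    proof -
      have "homotopic 0 (loop (word_of_walk i s) @ tree v0) (loop (word_of_walk i t) @ tree v0)"
        by (rule homotopic_append_right[OF homotopic_loop_pres_eq[OF eq], where y = 0]) (simp_all add: walk_end_tree[OF v0])
      then have "homotopic 0 (tree v0 @ s) (tree v0 @ t)"
        using homotopic_tree_walk[OF st(3)] homotopic_tree_walk[OF st(4)] by (meson h_sym h_trans)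
      then show ?thesis by (rule homotopic_cancel_left[OF _ walk_end_tree[OF v0]])
    qed
    then show ?thesis
      using htpy_word_of_walk[of i p q, where ?'k = 'k] by (auto simp: st J)
  qed
  show "\<exists>p\<in>?D. pres_eq (R i) (case p of (x, s) \<Rightarrow> word_of_walk i s) u" if "u \<in> lists (X i \<times> UNIV)" for u
  proof (rule bexI)
    show "(v0, tree_inv v0 @ loop u @ tree v0) \<in> ?D"
      using walk_end_tree[OF v0] walk_end_tree_inv[OF v0] by (simp add: walk_end_append)
    show "pres_eq (R i) (case (v0, tree_inv v0 @ loop u @ tree v0) of (x, s) \<Rightarrow> word_of_walk i s) u"
      using word_of_walk_loop[OF that] by (simp add: pe_refl)
  qed
qed (auto intro: h_sym h_trans pe_refl pe_sym pe_trans pres_eq_append)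

end

theorem theorem1:
  fixes Gs :: "nat \<Rightarrow> ('g, 'm) monoid_scheme" and n :: nat
  assumes "alg_closed_field TYPE('k::field)"
    and "\<forall>i<n. finitely_presented (Gs i)"
  shows "\<exists>Q. finite_quiver Q \<and> connected_quiver Q \<and> no_oriented_cycles Q \<and>
    (\<exists>I :: nat \<Rightarrow> (path \<Rightarrow> 'k) set.
       (\<forall>i<n. admissible Q (I i)) \<and>
       (\<forall>i<n. \<forall>j<n. quotients_iso Q (I i) (I j)) \<and>
       (\<forall>i<n. \<forall>v0\<in>verts Q. pi1 Q (I i) v0 \<cong> Gs i))"
proof -
  have "\<forall>i\<in>{..<n}. \<exists>X R. finite X \<and> finite R \<and> R \<subseteq> lists (X \<times> UNIV) \<and> Gs i \<cong> presented_group X R"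
    using assms(2) by (auto simp: finitely_presented_def)
  then obtain X R where "\<forall>i\<in>{..<n}. finite (X i) \<and> finite (R i) \<and> R i \<subseteq> lists (X i \<times> UNIV) \<and>
      Gs i \<cong> presented_group (X i) (R i)"
    unfolding bchoice_iff by blast
  then have XR: "\<And>i. i < n \<Longrightarrow> finite (X i)" "\<And>i. i < n \<Longrightarrow> finite (R i)"
      "\<And>i. i < n \<Longrightarrow> R i \<subseteq> lists (X i \<times> UNIV)" "\<And>i. i < n \<Longrightarrow> Gs i \<cong> presented_group (X i) (R i)"
    by auto
  \<comment> \<open>The extra element \<open>1\<close> makes the maximum exist and be positive even
    if there are no relators.\<close>
  define L where "L = insert 1 (length ` (\<Union>i<n. R i))"
  have "finite L" using XR(2) by (auto simp: L_def)
  then have Max: "l \<le> Max L" if "l \<in> L" for l using that by simp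
  interpret group_family n "Max L" X R
  proof
    show "1 \<le> Max L" by (rule Max) (simp add: L_def)
    show "length r \<le> Max L" if "i < n" "r \<in> R i" for i r
      by (rule Max) (use that in \<open>auto simp: L_def\<close>)
  qed (use XR in auto)
  have "pi1 Q (ideal i :: (path \<Rightarrow> 'k) set) v0 \<cong> Gs i" if "i < n" "v0 \<in> verts Q" for i v0
  proof -
    interpret group_family_at n "Max L" X R i "ideal i :: (path \<Rightarrow> 'k) set"
      by standard (use that in auto)
    \<comment> \<open>The given isomorphism starts at \<open>Gs i\<close>; knowing that this is a
      group allows it to be reversed.\<close>
    have "group (Gs i)" using assms(2) that by (simp add: finitely_presented_def)
    then have "presented_group (X i) (R i) \<cong> Gs i" using group.iso_sym XR(4) that by blast
    then show ?thesis using pi1_iso[OF that(2)] iso_trans by blast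
  qed
  then show ?thesis
    using finite_quiver_Q connected_quiver_Q no_oriented_cycles_Q admissible_ideal quotients_iso_ideal
    by (intro exI[of _ Q] conjI exI[of _ ideal]) auto
qed

end
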